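(* Let $T$ and $S$ be two trees, each containing at least one edge. Then $\mathrm{ex}(n,T\Box S)=\Theta_{T,S}(n^{3/2})$; that is, there are constants $c,C>0$ depending only on $T$ and $S$ such that $c\,n^{3/2}\le \mathrm{ex}(n,T\Box S)\le C\,n^{3/2}$ for all sufficiently large positive integers $n$.
   Context: All graphs are finite and simple. For a graph $F$ and a positive integer $n$, the Turán number $\mathrm{ex}(n,F)$ is the maximum number of edges in an $n$-vertex graph containing no subgraph isomorphic to $F$. For graphs $F$ and $G$, the Cartesian product $F\Box G$ is the graph with vertex set $V(F)\times V(G)$ in which $(u,v)$ and $(u',v')$ are adjacent if and only if either $u=u'$ and $vv'\in E(G)$, or $v=v'$ and $uu'\in E(F)$. *)

theory Defs
  imports Complex_Main "Graph_Theory.Graph_Theory"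
begin

text \<open>
  A finite simple graph is a \<^locale>\<open>pair_graph\<close>: a finite vertex set with a finite, symmetric and
  irreflexive adjacency relation \<^const>\<open>parcs\<close>. Each undirected edge is therefore represented by two
  opposite arcs, and edges have to be counted as two-element sets.
\<close>

definition uedges :: "'a pair_pre_digraph \<Rightarrow> 'a set set" where
  "uedges G = (\<lambda>(u, v). {u, v}) ` parcs G"

text \<open>
  The constants \<^const>\<open>forest\<close> and \<^const>\<open>tree\<close> of the graph library are unsuitable for symmetric
  digraphs, because going back and forth along an edge is a \<^const>\<open>pre_digraph.cycle\<close> there
  (of length 2). In a graph without loops the cycles in the undirected sense are exactly those
  of length at least 3.
\<close>

definition tree_graph :: "'a pair_pre_digraph \<Rightarrow> bool" where
  "tree_graph G \<longleftrightarrow> pair_graph G \<and> Digraph_Component.connected (with_proj G) \<and>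
     \<not> (\<exists>p. pre_digraph.cycle (with_proj G) p \<and> length p \<ge> 3)"

definition box_product ::
    "'a pair_pre_digraph \<Rightarrow> 'b pair_pre_digraph \<Rightarrow> ('a \<times> 'b) pair_pre_digraph" where
  "box_product F G = \<lparr> pverts = pverts F \<times> pverts G,
     parcs = {((u, v), (u', v')). u \<in> pverts F \<and> u' \<in> pverts F \<and> v \<in> pverts G \<and> v' \<in> pverts G \<and>
       (u = u' \<and> (v, v') \<in> parcs G \<or> v = v' \<and> (u, u') \<in> parcs F)} \<rparr>"

definition contains_copy :: "'a pair_pre_digraph \<Rightarrow> 'b pair_pre_digraph \<Rightarrow> bool" where
  "contains_copy G F \<longleftrightarrow>
     (\<exists>H :: 'a pair_pre_digraph. subgraph (with_proj H) (with_proj G) \<and>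
        digraph_iso (with_proj F) (with_proj H))"

text \<open>
  Vertices are taken from \<^typ>\<open>nat\<close>; every finite graph is isomorphic to such a graph. The maximum
  is over a finite set, which is nonempty as soon as \<open>F\<close> has an edge.
\<close>

definition turan_number :: "nat \<Rightarrow> 'a pair_pre_digraph \<Rightarrow> nat" where
  "turan_number n F = Max {card (uedges G) | G :: nat pair_pre_digraph.
     pair_graph G \<and> card (pverts G) = n \<and> \<not> contains_copy G F}"

lemma pair_graph_box_product:
  assumes "pair_graph F" "pair_graph G"
  shows "pair_graph (box_product F G)"
proof -
  interpret F: pair_graph F by fact
  interpret G: pair_graph G by fact
  have fin: "finite (parcs (box_product F G))"
    by (rule finite_subset[of _ "(pverts F \<times> pverts G) \<times> (pverts F \<times> pverts G)"])
       (auto simp: box_product_def F.pair_finite_verts G.pair_finite_verts)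
  show ?thesis
  proof
    show "symmetric (with_proj (box_product F G))"
      using F.graph_symmetric G.graph_symmetric
      by (auto simp: symmetric_def sym_def box_product_def)
  qed (use fin F.pair_no_loops G.pair_no_loops in
        \<open>auto simp: box_product_def F.pair_finite_verts G.pair_finite_verts\<close>)
qed

lemma contains_copy_iff_embedding:
  assumes "pair_graph F" "pair_graph G"
  shows "contains_copy G F \<longleftrightarrow>
    (\<exists>f. inj_on f (pverts F) \<and> f ` pverts F \<subseteq> pverts G \<and>
         (\<forall>u v. (u, v) \<in> parcs F \<longrightarrow> (f u, f v) \<in> parcs G))"
proof
  assume "contains_copy G F"
  then obtain H :: "'b pair_pre_digraph" and h where
    H: "subgraph (with_proj H) (with_proj G)"
    and h: "pre_digraph.digraph_isomorphism (with_proj F) h" "with_proj H = app_iso h (with_proj F)"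
    unfolding contains_copy_def digraph_iso_def by blast
  have eq: "pverts H = iso_verts h ` pverts F" "parcs H = iso_arcs h ` parcs F"
      "iso_tail h = fst" "iso_head h = snd"
    using h(2) by (auto simp: with_proj_def app_iso_def)
  have sub: "pverts H \<subseteq> pverts G" "parcs H \<subseteq> parcs G"
    using H by (auto simp: subgraph_def)
  have arc: "(iso_verts h u, iso_verts h v) = iso_arcs h (u, v)" if "(u, v) \<in> parcs F" for u v
    using h(1) that eq(3,4) unfolding pre_digraph.digraph_isomorphism_def
    by (metis fst_conv snd_conv prod.collapse with_proj_simps(2,4,5))
  show "\<exists>f. inj_on f (pverts F) \<and> f ` pverts F \<subseteq> pverts G \<and>
         (\<forall>u v. (u, v) \<in> parcs F \<longrightarrow> (f u, f v) \<in> parcs G)"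
  proof (intro exI[of _ "iso_verts h"] conjI allI impI)
    show "inj_on (iso_verts h) (pverts F)"
      using h(1) by (simp add: pre_digraph.digraph_isomorphism_def)
    show "iso_verts h ` pverts F \<subseteq> pverts G"
      using eq(1) sub(1) by simp
    show "(iso_verts h u, iso_verts h v) \<in> parcs G" if "(u, v) \<in> parcs F" for u v
      using arc[OF that] eq(2) sub(2) that by auto
  qed
next
  interpret F: pair_graph F by fact
  interpret G: pair_graph G by fact
  assume "\<exists>f. inj_on f (pverts F) \<and> f ` pverts F \<subseteq> pverts G \<and>
         (\<forall>u v. (u, v) \<in> parcs F \<longrightarrow> (f u, f v) \<in> parcs G)"
  then obtain f where f: "inj_on f (pverts F)" "f ` pverts F \<subseteq> pverts G"
      "\<And>u v. (u, v) \<in> parcs F \<Longrightarrow> (f u, f v) \<in> parcs G"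
    by blast
  define H where "H = \<lparr> pverts = f ` pverts F, parcs = map_prod f f ` parcs F \<rparr>"
  define h where "h = \<lparr> iso_verts = f, iso_arcs = map_prod f f, iso_head = snd, iso_tail = fst \<rparr>"
  have "wf_digraph (with_proj H)"
    by unfold_locales (auto simp: H_def dest: F.wellformed')
  then have "subgraph (with_proj H) (with_proj G)"
    using f(2,3) G.wf_digraph by (auto simp: subgraph_def H_def)
  moreover have "inj_on (map_prod f f) (parcs F)"
    by (rule inj_on_subset[OF map_prod_inj_on[OF f(1) f(1)]]) (auto dest: F.wellformed')
  then have "pre_digraph.digraph_isomorphism (with_proj F) h"
    using f(1) F.wf_digraph by (auto simp: pre_digraph.digraph_isomorphism_def h_def)
  moreover have "with_proj H = app_iso h (with_proj F)"
    by (simp add: H_def h_def app_iso_def with_proj_def)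
  ultimately show "contains_copy G F"
    unfolding contains_copy_def digraph_iso_def by blast
qed

lemma turan_number_attained:
  fixes F :: "'a pair_pre_digraph"
  assumes "pair_graph F" "parcs F \<noteq> {}"
  shows "finite {card (uedges G) | G :: nat pair_pre_digraph.
           pair_graph G \<and> card (pverts G) = n \<and> \<not> contains_copy G F}" (is "finite ?A")
    and "{card (uedges G) | G :: nat pair_pre_digraph.
           pair_graph G \<and> card (pverts G) = n \<and> \<not> contains_copy G F} \<noteq> {}"
proof -
  have "card (uedges G) \<le> n * n" if "pair_graph G" "card (pverts G) = n"
    for G :: "nat pair_pre_digraph"
  proof -
    interpret G: pair_graph G by fact
    have "card (uedges G) \<le> card (parcs G)"
      unfolding uedges_def by (rule card_image_le[OF G.pair_finite_arcs])
    also have "\<dots> \<le> card (pverts G \<times> pverts G)"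
      by (rule card_mono) (auto simp: G.pair_finite_verts dest: G.wellformed')
    finally show ?thesis
      using that(2) by (simp add: card_cartesian_product)
  qed
  then have "?A \<subseteq> {..n * n}"
    by auto
  then show "finite ?A"
    by (rule finite_subset) simp
  define E where "E = \<lparr> pverts = {..<n}, parcs = {} :: nat rel \<rparr>"
  have E: "pair_graph E"
    by unfold_locales (auto simp: E_def symmetric_def sym_def)
  have "\<not> contains_copy E F"
    using assms(2) unfolding contains_copy_iff_embedding[OF assms(1) E] by (auto simp: E_def)
  with E have "card (uedges E) \<in> ?A"
    unfolding mem_Collect_eq by (intro exI[of _ E]) (simp add: E_def)
  then show "?A \<noteq> {}"
    by blast
qed

end

theory Submission
  imports Defs "HOL-Algebra.Algebraic_Closure_Type" "HOL-Library.Z2"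
begin

text \<open>
  Upper bound: in a graph with \<open>n\<close> vertices and minimum degree \<open>\<delta>\<close>, map the root row and the root
  column of \<open>T \<box> S\<close> to random walks. Map every other vertex \<open>(u, v)\<close> to a random common neighbour of
  the images of \<open>(parent u, v)\<close> and \<open>(u, parent v)\<close>, drawn from the law of the middle vertex of a
  stationary random walk with these two neighbours. Such a resampling preserves the law of a
  stationary walk, so every staircase in \<open>T \<box> S\<close> is mapped to a stationary walk. Hence two given
  vertices collide with probability at most \<open>n / \<delta>\<^sup>2\<close>, and if \<open>\<delta>\<close> is a large multiple of \<open>sqrt n\<close>,
  then the map is injective with positive probability.

  Lower bound: \<open>T \<box> S\<close> contains a four-cycle, whereas a point-line incidence graph over a finite
  field does not.
\<close>

section \<open>Stationary random walks\<close>

text \<open>Arcs of \<open>E\<close> may leave \<open>V\<close>, but only those inside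
  \<open>V\<close> are counted. So the locale applies to a set of vertices together with all arcs of
  the surrounding graph.\<close>

locale host =
  fixes V :: "'v set" and E :: "('v \<times> 'v) set"
  assumes finite_V: "finite V"
    and sym_E: "(x, y) \<in> E \<Longrightarrow> (y, x) \<in> E"
    and nbr_V: "x \<in> V \<Longrightarrow> \<exists>y\<in>V. (x, y) \<in> E"
    and V_nonempty: "V \<noteq> {}"
begin

definition deg :: "'v \<Rightarrow> real" where
  "deg x = (\<Sum>y\<in>V. of_bool ((x, y) \<in> E))"

definition vol :: real where "vol = (\<Sum>x\<in>V. deg x)"

definition stat :: "'v \<Rightarrow> real" where "stat x = deg x / vol"

definition step :: "'v \<Rightarrow> 'v \<Rightarrow> real" where
  "step x y = of_bool ((x, y) \<in> E) / deg x"

text \<open>A codegree in which a common neighbour \<open>w\<close> has weight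
  \<open>1 / deg w\<close>. Divided by \<open>deg a\<close>, it is the probability that two steps
  lead from \<open>a\<close> to \<open>x\<close>.\<close>

definition common :: "'v \<Rightarrow> 'v \<Rightarrow> real" where
  "common x a = (\<Sum>w\<in>V. of_bool ((x, w) \<in> E \<and> (a, w) \<in> E) / deg w)"

text \<open>The conditional law of the middle vertex of a stationary path with the end vertices
  \<open>x\<close> and \<open>a\<close>. The uniform law is used where this makes no sense.\<close>

definition flip :: "'v \<Rightarrow> 'v \<Rightarrow> 'v \<Rightarrow> real" where
  "flip x a z = (if common x a = 0 then 1 / card V
     else of_bool ((x, z) \<in> E \<and> (a, z) \<in> E) / deg z / common x a)"

text \<open>\<open>path_mean n \<phi>\<close> is the expectation of \<open>\<phi>\<close> over the stationary walk with \<open>n\<close> steps.\<close>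

primrec path_mean :: "nat \<Rightarrow> ('v list \<Rightarrow> real) \<Rightarrow> real" where
  "path_mean 0 \<phi> = (\<Sum>x\<in>V. stat x * \<phi> [x])"
| "path_mean (Suc n) \<phi> = path_mean n (\<lambda>ys. \<Sum>z\<in>V. step (hd ys) z * \<phi> (z # ys))"

lemma E_commute: "(x, y) \<in> E \<longleftrightarrow> (y, x) \<in> E"
  using sym_E by blast

lemma deg_pos: "x \<in> V \<Longrightarrow> deg x > 0"
proof -
  assume "x \<in> V"
  then obtain y where "y \<in> V" "(x, y) \<in> E"
    using nbr_V by blast
  then show ?thesis
    unfolding deg_def by (intro sum_pos2[OF finite_V]) auto
qed

lemma deg_nonneg: "deg x \<ge> 0"
  unfolding deg_def by (simp add: sum_nonneg)

lemma deg_le: "deg x \<le> card V"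
  unfolding deg_def using sum_bounded_above[of V "\<lambda>y. of_bool ((x, y) \<in> E) :: real" 1] by simp

lemma vol_pos: "vol > 0"
  unfolding vol_def using deg_pos finite_V V_nonempty by (intro sum_pos) auto

lemma sum_stat: "(\<Sum>x\<in>V. stat x) = 1"
  using vol_pos by (simp add: stat_def vol_def flip: sum_divide_distrib)

lemma sum_step: "x \<in> V \<Longrightarrow> (\<Sum>y\<in>V. step x y) = 1"
  using deg_pos[of x] by (simp add: step_def deg_def flip: sum_divide_distrib)

text \<open>The uniform default covers the pairs without common neighbours, so resampling never
  needs a side condition.\<close>

lemma sum_flip: "(\<Sum>z\<in>V. flip x a z) = 1"
proof (cases "common x a = 0")
  case True
  then show ?thesis
    using finite_V V_nonempty by (simp add: flip_def)
next
  case False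
  then have "(\<Sum>z\<in>V. flip x a z) = common x a / common x a"
    unfolding flip_def by (subst (3) common_def) (simp add: sum_divide_distrib)
  with False show ?thesis
    by simp
qed

lemma stat_nonneg: "stat x \<ge> 0"
  using vol_pos deg_nonneg[of x] by (simp add: stat_def)

lemma step_nonneg: "step x y \<ge> 0"
  using deg_nonneg[of x] by (simp add: step_def)

lemma common_nonneg: "common x a \<ge> 0"
  unfolding common_def using deg_nonneg by (intro sum_nonneg) simp

lemma flip_nonneg: "flip x a z \<ge> 0"
  using common_nonneg[of x a] deg_nonneg[of z] by (simp add: flip_def)

text \<open>Detailed balance: along an edge both sides are \<open>1 / vol\<close>. This
  reversibility lets a stationary walk grow at either end.\<close>

lemma stat_step_sym: "x \<in> V \<Longrightarrow> y \<in> V \<Longrightarrow> stat x * step x y = stat y * step y x"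
  using deg_pos[of x] deg_pos[of y] by (simp add: stat_def step_def E_commute[of x y])

lemma sum_step_step: "(\<Sum>b\<in>V. step a b * step b x) = common x a / deg a"
  unfolding common_def sum_divide_distrib
  by (intro sum.cong) (auto simp: step_def E_commute[of x])

text \<open>Bayes' rule for the middle vertex of a two-step walk from \<open>a\<close> to
  \<open>x\<close>. If \<open>common x a\<close> vanishes, then so do both sides, whatever the
  default of \<open>flip\<close> is.\<close>

lemma common_flip:
  assumes "z \<in> V"
  shows "common x a / deg a * flip x a z = step a z * step z x"
proof (cases "common x a = 0")
  case True
  then have "\<forall>w\<in>V. of_bool ((x, w) \<in> E \<and> (a, w) \<in> E) / deg w = (0 :: real)"
    unfolding common_def using finite_V deg_nonneg
    by (subst (asm) sum_nonneg_eq_0_iff) auto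
  with assms deg_pos[OF assms] have "\<not> ((x, z) \<in> E \<and> (a, z) \<in> E)"
    by auto
  then show ?thesis
    using True by (auto simp: step_def E_commute[of x])
next
  case False
  then show ?thesis
    by (auto simp: flip_def step_def E_commute[of x])
qed

section \<open>Expectations over stationary walks\<close>

lemma path_mean_cong:
  assumes "\<And>ys. set ys \<subseteq> V \<Longrightarrow> length ys = Suc n \<Longrightarrow> \<phi> ys = \<psi> ys"
  shows "path_mean n \<phi> = path_mean n \<psi>"
  using assms
proof (induction n arbitrary: \<phi> \<psi>)
  case (Suc n)
  show ?case
    unfolding path_mean.simps
  proof (rule Suc.IH, intro sum.cong refl arg_cong2[where f = "(*)"])
    show "\<phi> (z # ys) = \<psi> (z # ys)" if "set ys \<subseteq> V" "length ys = Suc n" "z \<in> V" for ys z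
      using that by (intro Suc.prems) auto
  qed
qed auto

text \<open>Lists grow at the head. The vertex drawn last can be forgotten because its probabilities
  add up to one.\<close>

lemma path_mean_tl: "path_mean (Suc n) (\<lambda>ys. \<phi> (tl ys)) = path_mean n \<phi>"
  unfolding path_mean.simps
proof (rule path_mean_cong)
  fix ys :: "'v list" assume "set ys \<subseteq> V" "length ys = Suc n"
  then have "hd ys \<in> V"
    by (cases ys) auto
  then show "(\<Sum>z\<in>V. step (hd ys) z * \<phi> (tl (z # ys))) = \<phi> ys"
    by (simp add: sum_step flip: sum_distrib_right)
qed

text \<open>By reversibility the walk may also grow at the end of the list. The base case is
  detailed balance; the induction step swaps the sums for the two ends.\<close>

lemma path_mean_append:
  "path_mean (Suc n) \<phi> = path_mean n (\<lambda>ys. \<Sum>z\<in>V. step (last ys) z * \<phi> (ys @ [z]))"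
proof (induction n arbitrary: \<phi>)
  case 0
  have "path_mean (Suc 0) \<phi> = (\<Sum>x\<in>V. \<Sum>z\<in>V. stat z * step z x * \<phi> [z, x])"
    by (auto simp: sum_distrib_left stat_step_sym simp flip: mult.assoc intro!: sum.cong)
  also have "\<dots> = (\<Sum>z\<in>V. \<Sum>x\<in>V. stat z * step z x * \<phi> [z, x])"
    by (rule sum.swap)
  finally show ?case
    by (simp add: sum_distrib_left mult.assoc)
next
  case (Suc n)
  have "path_mean (Suc (Suc n)) \<phi> = path_mean n (\<lambda>ys. \<Sum>w\<in>V. step (last ys) w *
      (\<Sum>z\<in>V. step (hd (ys @ [w])) z * \<phi> (z # ys @ [w])))"
    by (subst path_mean.simps, subst Suc.IH) simp
  also have "\<dots> = path_mean n (\<lambda>ys. \<Sum>z\<in>V. step (hd ys) z *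
      (\<Sum>w\<in>V. step (last (z # ys)) w * \<phi> ((z # ys) @ [w])))"
  proof (rule path_mean_cong)
    fix ys :: "'v list" assume "length ys = Suc n"
    then have [simp]: "ys \<noteq> []"
      by auto
    show "(\<Sum>w\<in>V. step (last ys) w * (\<Sum>z\<in>V. step (hd (ys @ [w])) z * \<phi> (z # ys @ [w]))) =
      (\<Sum>z\<in>V. step (hd ys) z * (\<Sum>w\<in>V. step (last (z # ys)) w * \<phi> ((z # ys) @ [w])))"
      unfolding sum_distrib_left by (subst sum.swap) (simp add: mult.left_commute)
  qed
  finally show ?case
    by (simp only: path_mean.simps)
qed

lemma path_mean_butlast: "path_mean (Suc n) (\<lambda>ys. \<phi> (butlast ys)) = path_mean n \<phi>"
  unfolding path_mean_append
proof (rule path_mean_cong)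
  fix ys :: "'v list" assume "set ys \<subseteq> V" "length ys = Suc n"
  then have "last ys \<in> V"
    by (cases ys rule: rev_cases) auto
  then show "(\<Sum>z\<in>V. step (last ys) z * \<phi> (butlast (ys @ [z]))) = \<phi> ys"
    by (simp add: sum_step flip: sum_distrib_right)
qed

text \<open>A Gibbs sampling step: redrawing an inner vertex from its conditional law keeps the
  joint law. By the Markov property this law depends on the two neighbours only. The induction
  strips vertices off the head until the redrawn one is second.\<close>

lemma path_mean_flip:
  assumes "k + 2 \<le> n"
  shows "path_mean n (\<lambda>ys. \<Sum>z\<in>V. flip (ys ! k) (ys ! (k + 2)) z * \<phi> (ys[Suc k := z])) =
    path_mean n \<phi>"
  using assms
proof (induction k arbitrary: n \<phi>)
  case 0
  define m where "m = n - 2"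
  with 0 have n: "n = Suc (Suc m)"
    by simp
  show ?case
    unfolding n path_mean.simps
  proof (rule path_mean_cong)
    fix ys :: "'v list" assume ys: "length ys = Suc m"
    define a where "a = hd ys"
    have a: "ys ! 0 = a"
      using ys by (cases ys) (auto simp: a_def)
    \<comment> \<open>The old middle vertex \<open>b\<close> gets overwritten, so it occurs in the
      step weights only and can be summed out.\<close>
    have "(\<Sum>b\<in>V. step a b * (\<Sum>x\<in>V. step b x * (\<Sum>z\<in>V. flip x a z * \<phi> (x # z # ys)))) =
        (\<Sum>x\<in>V. \<Sum>z\<in>V. (\<Sum>b\<in>V. step a b * step b x) * flip x a z * \<phi> (x # z # ys))"
      unfolding sum_distrib_left sum_distrib_right
      by (subst sum.swap, rule sum.cong, rule refl, subst sum.swap) (simp add: mult.assoc)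
    also have "\<dots> = (\<Sum>x\<in>V. \<Sum>z\<in>V. step a z * step z x * \<phi> (x # z # ys))"
      by (intro sum.cong refl) (simp add: sum_step_step common_flip del: times_divide_eq_left)
    also have "\<dots> = (\<Sum>z\<in>V. step a z * (\<Sum>x\<in>V. step z x * \<phi> (x # z # ys)))"
      by (subst sum.swap) (simp add: sum_distrib_left mult.assoc)
    finally show "(\<Sum>b\<in>V. step (hd ys) b * (\<Sum>x\<in>V. step (hd (b # ys)) x *
          (\<Sum>z\<in>V. flip ((x # b # ys) ! 0) ((x # b # ys) ! (0 + 2)) z *
             \<phi> ((x # b # ys)[Suc 0 := z])))) =
        (\<Sum>z\<in>V. step (hd ys) z * (\<Sum>x\<in>V. step (hd (z # ys)) x * \<phi> (x # z # ys)))"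
      by (simp add: a flip: a_def)
  qed
next
  case (Suc k)
  then obtain m where n: "n = Suc m" and m: "k + 2 \<le> m"
    by (cases n) auto
  have "path_mean n (\<lambda>ys. \<Sum>z\<in>V. flip (ys ! Suc k) (ys ! (Suc k + 2)) z * \<phi> (ys[Suc (Suc k) := z]))
    = path_mean m (\<lambda>ys. \<Sum>z\<in>V. flip (ys ! k) (ys ! (k + 2)) z *
        (\<Sum>y\<in>V. step (hd (ys[Suc k := z])) y * \<phi> (y # ys[Suc k := z])))"
    unfolding n path_mean.simps
  proof (rule path_mean_cong)
    fix ys :: "'v list" assume "length ys = Suc m"
    \<comment> \<open>The update is at a positive position, so the weight of the newest step does
      not change.\<close>
    then have hd: "hd (ys[Suc k := z]) = hd ys" for z
      by (cases ys) auto
    show "(\<Sum>y\<in>V. step (hd ys) y * (\<Sum>z\<in>V. flip ((y # ys) ! Suc k) ((y # ys) ! (Suc k + 2)) z *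
            \<phi> ((y # ys)[Suc (Suc k) := z]))) =
        (\<Sum>z\<in>V. flip (ys ! k) (ys ! (k + 2)) z *
          (\<Sum>y\<in>V. step (hd (ys[Suc k := z])) y * \<phi> (y # ys[Suc k := z])))"
      unfolding hd sum_distrib_left by (subst sum.swap) (simp add: mult.left_commute)
  qed
  also have "\<dots> = path_mean m (\<lambda>ys. \<Sum>y\<in>V. step (hd ys) y * \<phi> (y # ys))"
    by (rule Suc.IH[OF m])
  finally show ?case
    by (simp add: n)
qed

end

section \<open>Random homomorphisms from a product of trees\<close>

text \<open>Each parent function makes the naturals a tree with root 0. A finite tree becomes an
  initial segment once its vertices are numbered with parents first.\<close>

locale tree_process = host V E
  for V :: "'v set" and E :: "('v \<times> 'v) set" +
  fixes par par' :: "nat \<Rightarrow> nat"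
  assumes par_less: "0 < i \<Longrightarrow> par i < i"
    and par'_less: "0 < j \<Longrightarrow> par' j < j"
begin

text \<open>The neighbours of \<open>u\<close> in the product that must be mapped before
  \<open>u\<close>.\<close>

definition preds :: "nat \<times> nat \<Rightarrow> (nat \<times> nat) set" where
  "preds u = (if fst u = 0 then {} else {(par (fst u), snd u)}) \<union>
     (if snd u = 0 then {} else {(fst u, par' (snd u))})"

fun transition :: "(nat \<times> nat \<Rightarrow> 'v) \<Rightarrow> nat \<times> nat \<Rightarrow> 'v \<Rightarrow> real" where
  "transition Y (i, j) z =
     (if i = 0 \<and> j = 0 then stat z
      else if j = 0 then step (Y (par i, 0)) z
      else if i = 0 then step (Y (0, par' j)) z
      else flip (Y (i, par' j)) (Y (par i, j)) z)"

text \<open>\<open>mean us F Y\<close> is the expectation of \<open>F\<close> when the values at \<open>us\<close> are chosen at random one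
  after the other, starting from \<open>Y\<close>.\<close>

primrec mean :: "(nat \<times> nat) list \<Rightarrow> ((nat \<times> nat \<Rightarrow> 'v) \<Rightarrow> real) \<Rightarrow> (nat \<times> nat \<Rightarrow> 'v) \<Rightarrow> real"
where
  "mean [] F Y = F Y"
| "mean (u # us) F Y = (\<Sum>z\<in>V. transition Y u z * mean us F (Y(u := z)))"

text \<open>Sampling orders for which every transition reads only values already drawn. Lists grow
  at the end because the proofs peel off the vertex drawn last, while \<open>mean\<close> recurses
  from the front; \<open>mean_snoc\<close> links the two.\<close>

inductive admissible :: "(nat \<times> nat) list \<Rightarrow> bool" where
  Nil: "admissible []"
| snoc: "admissible us \<Longrightarrow> u \<notin> set us \<Longrightarrow> preds u \<subseteq> set us \<Longrightarrow> admissible (us @ [u])"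

lemma admissible_preds: "admissible us \<Longrightarrow> v \<in> set us \<Longrightarrow> preds v \<subseteq> set us"
  by (induction rule: admissible.induct) auto

text \<open>The vertex sampled first has no \<open>preds\<close>, which forces both coordinates to
  be 0.\<close>

lemma admissible_root: "admissible us \<Longrightarrow> us \<noteq> [] \<Longrightarrow> (0, 0) \<in> set us"
proof (induction rule: admissible.induct)
  case (snoc us u)
  then show ?case
    by (cases "us = []"; cases u) (auto simp: preds_def split: if_splits)
qed simp

lemma mean_snoc:
  "mean (us @ [u]) F Y = mean us (\<lambda>Y. \<Sum>z\<in>V. transition Y u z * F (Y(u := z))) Y"
  by (induction us arbitrary: Y) simp_all

text \<open>\<open>A\<close> collects vertices already mapped into \<open>V\<close>, which the
  induction along the list has to carry.\<close>

lemma mean_cong_aux: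
  assumes "\<And>Y. Y ` (A \<union> set us) \<subseteq> V \<Longrightarrow> F Y = G Y" "Y ` A \<subseteq> V"
  shows "mean us F Y = mean us G Y"
  using assms
proof (induction us arbitrary: Y A)
  case (Cons u us)
  show ?case
    unfolding mean.simps
  proof (intro sum.cong refl arg_cong2[where f = "(*)"])
    fix z assume "z \<in> V"
    show "mean us F (Y(u := z)) = mean us G (Y(u := z))"
      using Cons.prems \<open>z \<in> V\<close> by (intro Cons.IH[of "insert u A"]) auto
  qed
qed auto

lemma mean_cong:
  assumes "\<And>Y. Y ` set us \<subseteq> V \<Longrightarrow> F Y = G Y"
  shows "mean us F Y = mean us G Y"
  using mean_cong_aux[of "{}" us F G Y] assms by simp

lemma transition_nonneg: "transition Y u z \<ge> 0"
  by (cases u) (simp add: stat_nonneg step_nonneg flip_nonneg)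

lemma sum_transition:
  assumes "Y ` preds u \<subseteq> V"
  shows "(\<Sum>z\<in>V. transition Y u z) = 1"
  using assms by (cases u) (auto simp: preds_def sum_stat sum_step sum_flip split: if_splits)

lemma mean_mono:
  assumes "\<And>Y. F Y \<le> G Y"
  shows "mean us F Y \<le> mean us G Y"
  by (induction us arbitrary: Y) (auto intro!: sum_mono mult_left_mono transition_nonneg assms)

text \<open>The probabilistic method: a positive average must have a term of positive weight and
  positive value.\<close>

lemma mean_pos_imp_ex:
  assumes "mean us F Y > 0" "Y ` A \<subseteq> V"
  shows "\<exists>Y. Y ` (A \<union> set us) \<subseteq> V \<and> F Y > 0"
  using assms
proof (induction us arbitrary: Y A)
  case (Cons u us)
  then obtain z where z: "z \<in> V" "transition Y u z * mean us F (Y(u := z)) > 0"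
    by (metis (no_types, lifting) mean.simps(2) not_le sum_nonpos)
  then have "mean us F (Y(u := z)) > 0"
    using transition_nonneg[of Y u z] by (simp add: zero_less_mult_iff)
  moreover have "(Y(u := z)) ` insert u A \<subseteq> V"
    using Cons.prems(2) z(1) by auto
  ultimately have "\<exists>Y. Y ` (insert u A \<union> set us) \<subseteq> V \<and> F Y > 0"
    by (rule Cons.IH)
  then show ?case
    by simp
qed auto

lemma mean_diff: "mean us (\<lambda>Y. F Y - G Y) Y = mean us F Y - mean us G Y"
  by (induction us arbitrary: Y) (simp_all add: sum_subtractf right_diff_distrib)

lemma mean_sum: "mean us (\<lambda>Y. \<Sum>c\<in>C. F c Y) Y = (\<Sum>c\<in>C. mean us (F c) Y)"
proof (induction us arbitrary: Y)
  case (Cons u us)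
  show ?case
    unfolding mean.simps Cons.IH sum_distrib_left by (rule sum.swap)
qed simp

text \<open>The last draw is integrated out: its probabilities add up to one once the values at its
  \<open>preds\<close> lie in \<open>V\<close>.\<close>

lemma mean_snoc_indep:
  assumes "admissible (us @ [u])" "\<And>Y z. F (Y(u := z)) = F Y"
  shows "mean (us @ [u]) F Y = mean us F Y"
proof -
  have "preds u \<subseteq> set us"
    using assms(1) by cases auto
  then have "Y ` preds u \<subseteq> V" if "Y ` set us \<subseteq> V" for Y :: "nat \<times> nat \<Rightarrow> 'v"
    using that by blast
  then show ?thesis
    unfolding mean_snoc assms(2) sum_distrib_right[symmetric]
    by (intro mean_cong) (simp add: sum_transition)
qed

lemma mean_const: "admissible us \<Longrightarrow> mean us (\<lambda>Y. c) Y = c"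
proof (induction rule: admissible.induct)
  case (snoc us u)
  then show ?case
    by (subst mean_snoc_indep) (auto intro: admissible.snoc)
qed simp

text \<open>When \<open>(i, j)\<close> is sampled, its neighbours on a staircase through already sampled vertices can
  only be \<open>(i, par' j)\<close> and \<open>(par i, j)\<close>. So the staircase arises by a flip from the one through
  \<open>(par i, par' j)\<close>.\<close>

definition stair_step :: "nat \<times> nat \<Rightarrow> nat \<times> nat \<Rightarrow> bool" where
  "stair_step u v \<longleftrightarrow> (0 < fst u \<and> v = (par (fst u), snd u)) \<or> (0 < snd v \<and> u = (fst v, par' (snd v)))"

abbreviation staircase :: "(nat \<times> nat) list \<Rightarrow> bool" where
  "staircase \<equiv> successively stair_step"

text \<open>Along a staircase the first coordinate never grows, the second never drops, and each
  step changes one of them.\<close>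

lemma staircase_distinct:
  assumes "staircase l"
  shows "distinct l"
proof -
  define R :: "nat \<times> nat \<Rightarrow> nat \<times> nat \<Rightarrow> bool" where
    "R u v \<longleftrightarrow> fst v \<le> fst u \<and> snd u \<le> snd v \<and> u \<noteq> v" for u v
  have "stair_step u v \<Longrightarrow> R u v" for u v
    using par_less[of "fst u"] par'_less[of "snd v"]
    by (cases u; cases v) (auto simp: stair_step_def R_def)
  then have "successively R l"
    using assms successively_mono by blast
  moreover have "transp R"
    by (auto simp: transp_def R_def)
  ultimately have "sorted_wrt R l"
    by (simp add: successively_conv_sorted_wrt)
  then show ?thesis
    by (induction l) (auto simp: R_def)
qed

text \<open>Otherwise \<open>u\<close> would be one of the \<open>preds\<close> of the sampled
  vertex \<open>w\<close>, and hence sampled itself.\<close>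

lemma stair_step_last:
  assumes "stair_step w u" "u \<notin> set us" "admissible us" "w \<in> set us"
  shows "0 < snd u" "w = (fst u, par' (snd u))"
  using assms admissible_preds[of us w] by (auto simp: stair_step_def preds_def)

lemma stair_step_first:
  assumes "stair_step u w" "u \<notin> set us" "admissible us" "w \<in> set us"
  shows "0 < fst u" "w = (par (fst u), snd u)"
  using assms admissible_preds[of us w] by (auto simp: stair_step_def preds_def)

text \<open>Before the draw, the staircase \<open>l'\<close> through the opposite corner of the grid
  cell is a stationary walk by \<open>IH\<close>. Drawing \<open>(i, j)\<close> amounts to redrawing
  that corner, which \<open>path_mean_flip\<close> permits.\<close>

lemma mean_staircase_snoc_interior:
  assumes us: "admissible us"
    and l: "l = l1 @ (i, par' j) # (i, j) # (par i, j) # l2" "staircase l"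
      "(i, j) \<notin> set us" "set l \<subseteq> insert (i, j) (set us)" "0 < i" "0 < j"
    and IH: "\<And>l \<phi>. l \<noteq> [] \<Longrightarrow> staircase l \<Longrightarrow> set l \<subseteq> set us \<Longrightarrow>
      mean us (\<lambda>Y. \<phi> (map Y l)) Y = path_mean (length l - 1) \<phi>"
  shows "mean (us @ [(i, j)]) (\<lambda>Y. \<phi> (map Y l)) Y = path_mean (length l - 1) \<phi>"
proof -
  define k where "k = length l1"
  define l' where "l' = l1 @ (i, par' j) # (par i, par' j) # (par i, j) # l2"
  have dist: "distinct l"
    using l(2) by (rule staircase_distinct)
  have "(par i, j) \<in> set us"
    using l(1,4) par_less[OF l(5)] by auto
  then have "(par i, par' j) \<in> set us"
    using admissible_preds[OF us, of "(par i, j)"] l(6) by (auto simp: preds_def)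
  then have set_l': "set l' \<subseteq> set us"
    using l(1,4) dist by (auto simp: l'_def)
  have stair: "staircase l'"
    using l(2,5,6) unfolding l(1) l'_def
    by (auto simp: successively_append_iff stair_step_def)
  have "map (Y((i, j) := z)) l = (map Y l')[Suc k := z]" for Y :: "nat \<times> nat \<Rightarrow> 'v" and z
    using dist unfolding l(1) l'_def k_def by (auto simp: list_update_append)
  moreover have "map Y l' ! k = Y (i, par' j)" "map Y l' ! (k + 2) = Y (par i, j)"
    for Y :: "nat \<times> nat \<Rightarrow> 'v"
    by (simp_all add: l'_def k_def nth_append)
  ultimately have "mean (us @ [(i, j)]) (\<lambda>Y. \<phi> (map Y l)) Y =
      mean us (\<lambda>Y. (\<lambda>ys. \<Sum>z\<in>V. flip (ys ! k) (ys ! (k + 2)) z * \<phi> (ys[Suc k := z])) (map Y l')) Y"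
    using l(5,6) by (simp add: mean_snoc)
  also have "\<dots> = path_mean (length l' - 1)
      (\<lambda>ys. \<Sum>z\<in>V. flip (ys ! k) (ys ! (k + 2)) z * \<phi> (ys[Suc k := z]))"
    using set_l' stair by (intro IH) (auto simp: l'_def)
  also have "\<dots> = path_mean (length l - 1) \<phi>"
    by (subst path_mean_flip) (simp_all add: l(1) l'_def k_def)
  finally show ?thesis .
qed

text \<open>The invariant behind the upper bound. Only the vertex \<open>u\<close> sampled last
  needs care: if its \<open>preds\<close> lie on the staircase, then \<open>u\<close> starts or
  continues the walk or flips a corner; otherwise the missing ones are added at the ends and
  integrated out again.\<close>

lemma mean_staircase:
  assumes "admissible us" "l \<noteq> []" "staircase l" "set l \<subseteq> set us"
  shows "mean us (\<lambda>Y. \<phi> (map Y l)) Y = path_mean (length l - 1) \<phi>"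
  using assms
proof (induction arbitrary: l \<phi> rule: admissible.induct)
  case (snoc us u)
  obtain i j where u: "u = (i, j)"
    by (cases u)
  let ?P = "\<lambda>l. \<forall>\<phi>. mean (us @ [u]) (\<lambda>Y. \<phi> (map Y l)) Y = path_mean (length l - 1) \<phi>"
  have preds: "(par i, j) \<in> set us" if "0 < i"
    using snoc.hyps(3) that by (auto simp: preds_def u)
  have preds': "(i, par' j) \<in> set us" if "0 < j"
    using snoc.hyps(3) that by (auto simp: preds_def u)
  have core: "?P (l1 @ u # l2)"
    if l: "staircase (l1 @ u # l2)" "set (l1 @ u # l2) \<subseteq> insert u (set us)"
      and ne: "0 < i \<Longrightarrow> l2 \<noteq> []" "0 < j \<Longrightarrow> l1 \<noteq> []" for l1 l2
  proof
    fix \<phi> :: "'v list \<Rightarrow> real"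
    let ?l = "l1 @ u # l2"
    have dist: "distinct ?l"
      using l(1) by (rule staircase_distinct)
    have l1: "0 < j \<and> l1 = butlast l1 @ [(i, par' j)]" if "l1 \<noteq> []"
    proof -
      have "stair_step (last l1) u" "last l1 \<in> set us"
        using that l dist by (auto simp: successively_append_iff dest: last_in_set)
      from stair_step_last[OF this(1) snoc.hyps(2,1) this(2)] show ?thesis
        using that by (metis u fst_conv snd_conv append_butlast_last_id)
    qed
    have l2: "0 < i \<and> l2 = (par i, j) # tl l2" if "l2 \<noteq> []"
    proof -
      have "stair_step u (hd l2)" "hd l2 \<in> set us"
        using that l dist by (auto simp: successively_append_iff successively_Cons dest: hd_in_set)
      from stair_step_first[OF this(1) snoc.hyps(2,1) this(2)] show ?thesis
        using that by (metis u fst_conv snd_conv list.collapse)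
    qed
    show "mean (us @ [u]) (\<lambda>Y. \<phi> (map Y ?l)) Y = path_mean (length ?l - 1) \<phi>"
    \<comment> \<open>The four cases are the root, the two axes and the interior of the
      grid.\<close>
    proof (cases "l1 = []"; cases "l2 = []")
      assume [simp]: "l1 = []" "l2 = []"
      then have "i = 0" "j = 0"
        using ne by auto
      then show ?thesis
        using mean_const[OF snoc.hyps(1)] by (simp add: mean_snoc u)
    next
      assume [simp]: "l1 = []" and "l2 \<noteq> []"
      with l2 have i: "0 < i" "l2 = (par i, j) # tl l2" and "j = 0"
        using ne by auto
      have sub: "set l2 \<subseteq> set us" and stair: "staircase l2"
        using l dist by (auto simp: successively_Cons)
      have map_l: "map (Y(u := z)) ?l = z # map Y l2" for Y :: "nat \<times> nat \<Rightarrow> 'v" and z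
        using dist by (auto simp: u)
      have "Y (par i, 0) = hd (map Y l2)" for Y :: "nat \<times> nat \<Rightarrow> 'v"
        using \<open>j = 0\<close> by (subst i(2)) simp
      then have "mean (us @ [u]) (\<lambda>Y. \<phi> (map Y ?l)) Y =
          mean us (\<lambda>Y. (\<lambda>ys. \<Sum>z\<in>V. step (hd ys) z * \<phi> (z # ys)) (map Y l2)) Y"
        using i(1) \<open>j = 0\<close> unfolding mean_snoc map_l by (simp add: u)
      also have "\<dots> = path_mean (length l2 - 1) (\<lambda>ys. \<Sum>z\<in>V. step (hd ys) z * \<phi> (z # ys))"
        by (rule snoc.IH[OF \<open>l2 \<noteq> []\<close> stair sub])
      also have "\<dots> = path_mean (Suc (length l2 - 1)) \<phi>"
        by simp
      finally show ?thesis
        using \<open>l2 \<noteq> []\<close> by simp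
    next
      assume "l1 \<noteq> []" and [simp]: "l2 = []"
      with l1 have j: "0 < j" "l1 = butlast l1 @ [(i, par' j)]" and "i = 0"
        using ne by auto
      have sub: "set l1 \<subseteq> set us" and stair: "staircase l1"
        using l dist by (auto simp: successively_append_iff)
      have map_l: "map (Y(u := z)) ?l = map Y l1 @ [z]" for Y :: "nat \<times> nat \<Rightarrow> 'v" and z
        using dist by (auto simp: u)
      have "Y (0, par' j) = last (map Y l1)" for Y :: "nat \<times> nat \<Rightarrow> 'v"
        using \<open>i = 0\<close> by (subst j(2)) simp
      then have "mean (us @ [u]) (\<lambda>Y. \<phi> (map Y ?l)) Y =
          mean us (\<lambda>Y. (\<lambda>ys. \<Sum>z\<in>V. step (last ys) z * \<phi> (ys @ [z])) (map Y l1)) Y"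
        using j(1) \<open>i = 0\<close> unfolding mean_snoc map_l by (simp add: u)
      also have "\<dots> = path_mean (length l1 - 1) (\<lambda>ys. \<Sum>z\<in>V. step (last ys) z * \<phi> (ys @ [z]))"
        by (rule snoc.IH[OF \<open>l1 \<noteq> []\<close> stair sub])
      also have "\<dots> = path_mean (Suc (length l1 - 1)) \<phi>"
        by (rule path_mean_append[symmetric])
      finally show ?thesis
        using \<open>l1 \<noteq> []\<close> by simp
    next
      assume ne': "l1 \<noteq> []" "l2 \<noteq> []"
      have "?l = butlast l1 @ (i, par' j) # (i, j) # (par i, j) # tl l2"
        using l1[OF ne'(1)] l2[OF ne'(2)] by (metis append.assoc append_Cons append_Nil u)
      then show ?thesis
        using l1[OF ne'(1)] l2[OF ne'(2)] l snoc.hyps(1,2) snoc.IH unfolding u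
        by (intro mean_staircase_snoc_interior[where ?l1.0 = "butlast l1" and ?l2.0 = "tl l2"]) auto
    qed
  qed
  \<comment> \<open>If \<open>(par i, j)\<close> is missing, it is appended and then dropped by
    \<open>path_mean_butlast\<close>.\<close>
  have core': "?P (l1 @ u # l2)"
    if l: "staircase (l1 @ u # l2)" "set (l1 @ u # l2) \<subseteq> insert u (set us)"
      and ne: "0 < j \<Longrightarrow> l1 \<noteq> []" for l1 l2
  proof (cases "0 < i \<and> l2 = []")
    case True
    have "?P (l1 @ u # [(par i, j)])"
      using l True preds ne
      by (intro core) (auto simp: successively_append_iff stair_step_def u)
    then have "mean (us @ [u]) (\<lambda>Y. \<phi> (butlast (map Y (l1 @ u # [(par i, j)])))) Y =
        path_mean (Suc (length l1)) (\<lambda>ys. \<phi> (butlast ys))" for \<phi>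
      by (drule_tac x = "\<lambda>ys. \<phi> (butlast ys)" in spec) (simp del: path_mean.simps)
    then show ?thesis
      unfolding path_mean_butlast using True by (simp add: butlast_append)
  next
    case False
    then show ?thesis
      using l ne by (intro core) auto
  qed
  \<comment> \<open>Likewise a missing \<open>(i, par' j)\<close> is put in front and dropped by
    \<open>path_mean_tl\<close>.\<close>
  have core'': "?P (l1 @ u # l2)"
    if l: "staircase (l1 @ u # l2)" "set (l1 @ u # l2) \<subseteq> insert u (set us)" for l1 l2
  proof (cases "0 < j \<and> l1 = []")
    case True
    have "?P ([(i, par' j)] @ u # l2)"
      using l True preds' by (intro core') (auto simp: stair_step_def u)
    then have "mean (us @ [u]) (\<lambda>Y. \<phi> (tl (map Y ([(i, par' j)] @ u # l2)))) Y =
        path_mean (Suc (length l2)) (\<lambda>ys. \<phi> (tl ys))" for \<phi>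
      by (drule_tac x = "\<lambda>ys. \<phi> (tl ys)" in spec) (simp del: path_mean.simps)
    then show ?thesis
      unfolding path_mean_tl using True by simp
  next
    case False
    then show ?thesis
      using l by (intro core') auto
  qed
  show ?case
  proof (cases "u \<in> set l")
    case True
    then obtain l1 l2 where "l = l1 @ u # l2"
      by (meson split_list)
    then show ?thesis
      using core''[of l1 l2] snoc.prems by auto
  next
    case False
    then have map_l: "map (Y(u := z)) l = map Y l" for Y :: "nat \<times> nat \<Rightarrow> 'v" and z
      by auto
    have "mean (us @ [u]) (\<lambda>Y. \<phi> (map Y l)) Y = mean us (\<lambda>Y. \<phi> (map Y l)) Y"
      by (intro mean_snoc_indep admissible.snoc snoc.hyps) (simp only: map_l)
    then show ?thesis
      using snoc.IH[of l \<phi>] snoc.prems False by auto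
  qed
qed simp

text \<open>Two adjacent grid vertices form a staircase with one step, and a stationary walk moves
  along edges only.\<close>

lemma mean_edge:
  assumes "admissible us" "stair_step u v" "u \<in> set us" "v \<in> set us"
  shows "mean us (\<lambda>Y. of_bool ((Y u, Y v) \<notin> E)) Y = 0"
proof -
  have "mean us (\<lambda>Y. (\<lambda>ys. of_bool ((ys ! 0, ys ! 1) \<notin> E)) (map Y [u, v])) Y =
      path_mean (length [u, v] - 1) (\<lambda>ys. of_bool ((ys ! 0, ys ! 1) \<notin> E))"
    using assms by (intro mean_staircase) auto
  also have "\<dots> = (\<Sum>x\<in>V. stat x * (\<Sum>z\<in>V. step x z * of_bool ((z, x) \<notin> E)))"
    by simp
  also have "\<dots> = (\<Sum>x\<in>V. stat x * (\<Sum>z\<in>V. 0))"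
    by (intro sum.cong refl arg_cong2[where f = "(*)"]) (simp add: step_def E_commute[of _ x for x])
  finally show ?thesis
    by simp
qed

section \<open>Collision probabilities and the union bound\<close>

lemma flip_le:
  assumes "\<delta> > 0" "\<And>x. x \<in> V \<Longrightarrow> deg x \<ge> \<delta>" "z \<in> V"
  shows "flip x a z \<le> (if common x a = 0 then 1 else 1 / (\<delta> * common x a))"
proof (cases "common x a = 0")
  case True
  have "card V > 0"
    using finite_V V_nonempty by (simp add: card_gt_0_iff)
  with True show ?thesis
    by (simp add: flip_def)
next
  case False
  then have "common x a > 0"
    using common_nonneg[of x a] by simp
  moreover have "of_bool ((x, z) \<in> E \<and> (a, z) \<in> E) / deg z \<le> 1 / \<delta>"
    using assms(1) assms(2)[OF assms(3)] by (intro frac_le) auto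
  ultimately have "of_bool ((x, z) \<in> E \<and> (a, z) \<in> E) / deg z / common x a \<le> 1 / \<delta> / common x a"
    by (intro divide_right_mono) auto
  with False show ?thesis
    by (simp add: flip_def)
qed

text \<open>The weight \<open>stat x * step x b * step b a\<close> of all paths from \<open>x\<close> to \<open>a\<close> adds up to a multiple of
  \<^term>\<open>common x a\<close>, which cancels against the denominator of \<^const>\<open>flip\<close>.\<close>

lemma path_mean_flip_bound:
  assumes "\<delta> > 0" "\<And>x. x \<in> V \<Longrightarrow> deg x \<ge> \<delta>"
  shows "path_mean 2 (\<lambda>ys. if common (ys ! 0) (ys ! 2) = 0 then 1
      else 1 / (\<delta> * common (ys ! 0) (ys ! 2))) \<le> card V / \<delta>\<^sup>2"
proof -
  define g where "g x a = (if common x a = 0 then 1 else 1 / (\<delta> * common x a))" for x a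
  have "path_mean 2 (\<lambda>ys. g (ys ! 0) (ys ! 2)) =
      (\<Sum>a\<in>V. stat a * (\<Sum>b\<in>V. step a b * (\<Sum>x\<in>V. step b x * g x a)))"
    by (simp add: numeral_2_eq_2)
  also have "\<dots> = (\<Sum>a\<in>V. stat a * (\<Sum>x\<in>V. (\<Sum>b\<in>V. step a b * step b x) * g x a))"
    unfolding sum_distrib_left sum_distrib_right
    by (rule sum.cong, rule refl, subst sum.swap) (simp add: mult.assoc)
  also have "\<dots> = (\<Sum>a\<in>V. \<Sum>x\<in>V. common x a * g x a / vol)"
    unfolding sum_step_step sum_distrib_left
  proof (intro sum.cong refl)
    show "stat a * (common x a / deg a * g x a) = common x a * g x a / vol" if "a \<in> V" for a x
      using deg_pos[OF that] by (simp add: stat_def)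
  qed
  \<comment> \<open>Each product \<open>common x a * g x a\<close> is 0 or
    \<open>1 / \<delta>\<close>.\<close>
  also have "\<dots> \<le> (\<Sum>a\<in>V. \<Sum>x\<in>V. 1 / (\<delta> * vol))"
    using assms(1) vol_pos by (intro sum_mono) (auto simp: g_def)
  also have "\<dots> = card V * card V / (\<delta> * vol)"
    by simp
  also have "\<dots> \<le> card V * card V / (\<delta> * (card V * \<delta>))"
  proof (intro divide_left_mono mult_left_mono)
    have "(\<Sum>x\<in>V. \<delta>) \<le> vol"
      unfolding vol_def by (intro sum_mono assms(2))
    then show "card V * \<delta> \<le> vol"
      by simp
  qed (use assms(1) vol_pos finite_V V_nonempty in \<open>auto simp: card_gt_0_iff\<close>)
  also have "\<dots> = card V / \<delta>\<^sup>2"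
    using finite_V V_nonempty by (simp add: power2_eq_square)
  finally show ?thesis
    by (simp only: g_def)
qed

text \<open>Given the earlier values, \<open>u\<close> hits \<open>Y v\<close> with probability
  \<open>transition Y u (Y v)\<close>. On the axes this is at most \<open>1 / \<delta>\<close>. In
  the interior it is bounded by \<open>flip_le\<close> and averaged over the stationary two-step
  walk between the neighbours of \<open>u\<close>.\<close>

lemma mean_collision_new:
  assumes \<delta>: "\<delta> > 0" "\<And>x. x \<in> V \<Longrightarrow> deg x \<ge> \<delta>"
    and us: "admissible us" "u \<notin> set us" "preds u \<subseteq> set us" "v \<in> set us"
  shows "mean (us @ [u]) (\<lambda>Y. of_bool (Y u = Y v)) Y \<le> card V / \<delta>\<^sup>2"
proof -
  obtain i j where u: "u = (i, j)"
    by (cases u)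
  have "v \<noteq> u"
    using us by auto
  have "mean (us @ [u]) (\<lambda>Y. of_bool (Y u = Y v)) Y = mean us (\<lambda>Y. transition Y u (Y v)) Y"
    unfolding mean_snoc
  proof (rule mean_cong)
    fix Y :: "nat \<times> nat \<Rightarrow> 'v" assume "Y ` set us \<subseteq> V"
    then have "Y v \<in> V"
      using us(4) by auto
    then show "(\<Sum>z\<in>V. transition Y u z * of_bool ((Y(u := z)) u = (Y(u := z)) v)) = transition Y u (Y v)"
      using finite_V \<open>v \<noteq> u\<close> by (simp add: of_bool_def if_distrib sum.delta cong: if_cong)
  qed
  also have "\<dots> \<le> card V / \<delta>\<^sup>2"
  proof (cases "0 < i \<and> 0 < j")
    case True
    then have preds: "(par i, j) \<in> set us" "(i, par' j) \<in> set us"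
      using us(3) by (auto simp: preds_def u)
    then have corner: "(par i, par' j) \<in> set us"
      using admissible_preds[OF us(1), of "(par i, j)"] True by (auto simp: preds_def)
    define g where "g x a = (if common x a = 0 then 1 else 1 / (\<delta> * common x a))" for x a
    have flip_g: "flip x a z \<le> g x a" if "z \<in> V" for x a z
      unfolding g_def by (rule flip_le[OF \<delta> that])
    have g_nonneg: "g x a \<ge> 0" for x a
      using \<delta>(1) common_nonneg[of x a] by (simp add: g_def)
    let ?l = "[(i, par' j), (par i, par' j), (par i, j)]"
    \<comment> \<open>\<open>mean_mono\<close> compares at every \<open>Y\<close>, whereas
      \<open>flip_le\<close> needs \<open>Y v\<close> in \<open>V\<close>. The truncation repairs
      this without changing the mean.\<close>
    have "mean us (\<lambda>Y. transition Y u (Y v)) Y =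
        mean us (\<lambda>Y. if Y v \<in> V then transition Y u (Y v) else 0) Y"
      using us(4) by (intro mean_cong) auto
    also have "\<dots> \<le> mean us (\<lambda>Y. (\<lambda>ys. g (ys ! 0) (ys ! 2)) (map Y ?l)) Y"
      using True by (intro mean_mono) (auto simp: u flip_g g_nonneg)
    also have "\<dots> = path_mean (length ?l - 1) (\<lambda>ys. g (ys ! 0) (ys ! 2))"
      using preds corner True us(1) by (intro mean_staircase) (auto simp: stair_step_def)
    also have "\<dots> = path_mean 2 (\<lambda>ys. g (ys ! 0) (ys ! 2))"
      by (rule arg_cong[where f = "\<lambda>n. path_mean n _"]) simp
    also have "\<dots> \<le> card V / \<delta>\<^sup>2"
      using path_mean_flip_bound[OF \<delta>] by (simp only: g_def)
    finally show ?thesis .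
  next
    case False
    obtain x where "x \<in> V"
      using V_nonempty by blast
    then have "\<delta> \<le> card V"
      using \<delta>(2)[of x] deg_le[of x] by linarith
    then have "1 / \<delta> \<le> card V / \<delta>\<^sup>2"
      using \<delta>(1) by (simp add: field_simps power2_eq_square)
    moreover have "step x y \<le> 1 / \<delta>" if "x \<in> V" for x y
      using \<delta>(1) \<delta>(2)[OF that] by (auto simp: step_def intro!: frac_le)
    ultimately have step_le: "step x y \<le> card V / \<delta>\<^sup>2" if "x \<in> V" for x y
      using that by (meson order_trans)
    have "us \<noteq> []"
      using us(4) by auto
    \<comment> \<open>As \<open>v\<close> was drawn before, the root has been drawn too.\<close>
    then have "u \<noteq> (0, 0)"
      using admissible_root[OF us(1)] us(2) by auto
    then have transition_le: "transition Y u z \<le> card V / \<delta>\<^sup>2"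
      if "Y ` set us \<subseteq> V" for Y :: "nat \<times> nat \<Rightarrow> 'v" and z
      using False us(3) that by (auto simp: u preds_def intro!: step_le)
    \<comment> \<open>The minimum serves the same purpose as the truncation in the interior
      case.\<close>
    have "mean us (\<lambda>Y. transition Y u (Y v)) Y =
        mean us (\<lambda>Y. min (transition Y u (Y v)) (card V / \<delta>\<^sup>2)) Y"
      by (intro mean_cong) (simp add: min_def transition_le)
    also have "\<dots> \<le> mean us (\<lambda>Y. card V / \<delta>\<^sup>2) Y"
      by (intro mean_mono) simp
    finally show ?thesis
      using mean_const[OF us(1)] by simp
  qed
  finally show ?thesis .
qed

text \<open>The estimate is made when the later of the two vertices is drawn; subsequent draws do
  not affect the event.\<close>

lemma mean_collision:
  assumes \<delta>: "\<delta> > 0" "\<And>x. x \<in> V \<Longrightarrow> deg x \<ge> \<delta>"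
    and "admissible us" "u \<in> set us" "v \<in> set us" "u \<noteq> v"
  shows "mean us (\<lambda>Y. of_bool (Y u = Y v)) Y \<le> card V / \<delta>\<^sup>2"
  using assms(3-)
proof (induction rule: admissible.induct)
  case (snoc us w)
  consider "w = u" | "w = v" | "w \<noteq> u" "w \<noteq> v"
    by blast
  then show ?case
  proof cases
    case 1
    then show ?thesis
      using snoc mean_collision_new[OF \<delta>, of us u v] by auto
  next
    case 2
    then show ?thesis
      using snoc mean_collision_new[OF \<delta>, of us v u] by (auto simp: eq_commute)
  next
    case 3
    then have "mean (us @ [w]) (\<lambda>Y. of_bool (Y u = Y v)) Y = mean us (\<lambda>Y. of_bool (Y u = Y v)) Y"
      using snoc.hyps by (intro mean_snoc_indep admissible.snoc) auto
    then show ?thesis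
      using snoc.IH snoc.prems 3 by simp
  qed
qed simp

text \<open>First-moment argument: non-edges have probability zero, and the at most
  \<open>(length us)\<^sup>2\<close> possible collisions have total probability below 1.\<close>

lemma ex_embedding:
  fixes \<delta> :: real
  assumes \<delta>: "\<delta> > 0" "\<And>x. x \<in> V \<Longrightarrow> deg x \<ge> \<delta>"
    and us: "admissible us" "(length us)\<^sup>2 * card V < \<delta>\<^sup>2"
  shows "\<exists>Y. Y ` set us \<subseteq> V \<and> inj_on Y (set us) \<and>
    (\<forall>u\<in>set us. \<forall>v\<in>set us. stair_step u v \<longrightarrow> (Y u, Y v) \<in> E)"
proof -
  define P where "P = {(u, v) \<in> set us \<times> set us. stair_step u v}"
  define D where "D = {(u, v) \<in> set us \<times> set us. u \<noteq> v}"
  \<comment> \<open>The sums count bad events, so \<open>F Y\<close> is positive only if none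
    occurs.\<close>
  define F where "F Y = 1 - (\<Sum>c\<in>P. of_bool ((Y (fst c), Y (snd c)) \<notin> E)) -
    (\<Sum>c\<in>D. of_bool (Y (fst c) = Y (snd c)) :: real)" for Y :: "nat \<times> nat \<Rightarrow> 'v"
  have fin: "finite P" "finite D"
    by (rule finite_subset[of _ "set us \<times> set us"]; force simp: P_def D_def)+
  have "card D \<le> card (set us \<times> set us)"
    by (rule card_mono) (auto simp: D_def)
  also have "\<dots> \<le> (length us)\<^sup>2"
    by (simp add: card_cartesian_product power2_eq_square mult_mono card_length)
  finally have card_D: "card D \<le> (length us)\<^sup>2" .
  define Y0 :: "nat \<times> nat \<Rightarrow> 'v" where "Y0 = undefined"
  have "mean us (\<lambda>Y. \<Sum>c\<in>P. of_bool ((Y (fst c), Y (snd c)) \<notin> E)) Y0 = 0"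
    unfolding mean_sum using us(1) by (intro sum.neutral) (auto simp: P_def mean_edge)
  moreover have "mean us (\<lambda>Y. \<Sum>c\<in>D. of_bool (Y (fst c) = Y (snd c))) Y0 \<le>
      (\<Sum>c\<in>D. card V / \<delta>\<^sup>2)"
    unfolding mean_sum using us(1) by (intro sum_mono mean_collision[OF \<delta>]) (auto simp: D_def)
  moreover have "(\<Sum>c\<in>D. card V / \<delta>\<^sup>2) \<le> (length us)\<^sup>2 * (card V / \<delta>\<^sup>2)"
    using card_D by (simp only: sum_constant) (intro mult_right_mono, auto)
  moreover have "(length us)\<^sup>2 * (card V / \<delta>\<^sup>2) < 1"
    using us(2) \<delta>(1) by (simp add: field_simps)
  ultimately have "mean us F Y0 > 0"
    unfolding F_def mean_diff mean_const[OF us(1)] by linarith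
  from mean_pos_imp_ex[OF this, of "{}"] obtain Y where Y: "Y ` set us \<subseteq> V" "F Y > 0"
    by auto
  have pos: "(\<Sum>c\<in>P. of_bool ((Y (fst c), Y (snd c)) \<notin> E)) +
      (\<Sum>c\<in>D. of_bool (Y (fst c) = Y (snd c))) < (1 :: real)"
    using Y(2) by (simp add: F_def)
  have "(Y u, Y v) \<in> E" if "(u, v) \<in> P" for u v
  proof (rule ccontr)
    assume "(Y u, Y v) \<notin> E"
    then have "1 \<le> (\<Sum>c\<in>P. of_bool ((Y (fst c), Y (snd c)) \<notin> E) :: real)"
      using member_le_sum[OF that, of "\<lambda>c. of_bool ((Y (fst c), Y (snd c)) \<notin> E) :: real"] fin by simp
    moreover have "0 \<le> (\<Sum>c\<in>D. of_bool (Y (fst c) = Y (snd c)) :: real)"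
      by (intro sum_nonneg) simp
    ultimately show False
      using pos by linarith
  qed
  moreover have "Y u \<noteq> Y v" if "(u, v) \<in> D" for u v
  proof
    assume "Y u = Y v"
    then have "1 \<le> (\<Sum>c\<in>D. of_bool (Y (fst c) = Y (snd c)) :: real)"
      using member_le_sum[OF that, of "\<lambda>c. of_bool (Y (fst c) = Y (snd c)) :: real"] fin by simp
    moreover have "0 \<le> (\<Sum>c\<in>P. of_bool ((Y (fst c), Y (snd c)) \<notin> E) :: real)"
      by (intro sum_nonneg) simp
    ultimately show False
      using pos by linarith
  qed
  ultimately show ?thesis
    using Y(1) unfolding P_def D_def inj_on_def by blast
qed

end

section \<open>Trees\<close>

text \<open>The vertices of a tree can be listed in such a way that every vertex but the first has exactly
  one neighbour among its predecessors, its parent.\<close>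

definition tree_list :: "'a pair_pre_digraph \<Rightarrow> 'a list \<Rightarrow> bool" where
  "tree_list G xs \<longleftrightarrow> distinct xs \<and> xs \<noteq> [] \<and> set xs \<subseteq> pverts G \<and>
     (\<forall>i<length xs. 0 < i \<longrightarrow> (\<exists>!j. j < i \<and> (xs ! i, xs ! j) \<in> parcs G)) \<and>
     (\<forall>p\<in>set xs. \<forall>q\<in>set xs. \<exists>w. pre_digraph.awalk (with_proj G) p w q \<and> set w \<subseteq> set xs \<times> set xs)"

text \<open>Two neighbours \<open>p\<close> and \<open>q\<close> would be joined by a path inside
  the list, as the last clause of \<open>tree_list\<close> provides a walk there. Together with
  \<open>v\<close> it would close a cycle of length at least 3.\<close>

lemma tree_list_unique_neighbour:
  assumes G: "tree_graph G" and xs: "tree_list G xs"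
    and v: "v \<notin> set xs" "p \<in> set xs" "q \<in> set xs" "(v, p) \<in> parcs G" "(v, q) \<in> parcs G"
  shows "p = q"
proof (rule ccontr)
  assume "p \<noteq> q"
  interpret pair_graph G
    using G by (simp add: tree_graph_def)
  obtain w where w: "awalk p w q" "set w \<subseteq> set xs \<times> set xs"
    using xs v(2,3) unfolding tree_list_def by blast
  define w' where "w' = awalk_to_apath w"
  have w': "apath p w' q" "set w' \<subseteq> set xs \<times> set xs"
    using apath_awalk_to_apath[OF w(1)] awalk_to_apath_subset[OF w(1)] w(2) by (auto simp: w'_def)
  then have walk: "awalk p w' q" and dist: "distinct (awalk_verts p w')"
    by (auto simp: apath_def)
  have "w' \<noteq> []"
    using walk \<open>p \<noteq> q\<close> by (auto simp: awalk_Nil_iff)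
  define c where "c = (v, p) # w' @ [(q, v)]"
  have "(q, v) \<in> parcs G"
    by (rule arcs_symmetric[OF v(5)])
  then have qv: "awalk q [(q, v)] v"
    by (auto simp: awalk_Cons_iff awalk_Nil_iff dest: wellformed')
  have "awalk p (w' @ [(q, v)]) v"
    by (rule awalk_appendI[OF walk qv])
  then have c: "awalk v c v"
    unfolding c_def awalk_Cons_iff using v(4) by simp
  have tl_c: "distinct (tl (awalk_verts v c))"
  proof -
    have "last (awalk_verts p w') = q"
      using walk awlast_if_cas[of p w' q] by (simp add: awalk_def)
    then have verts: "awalk_verts p w' = map fst w' @ [q]"
      using \<open>w' \<noteq> []\<close> by (simp add: awalk_verts_conv)
    have "awalk_verts p (w' @ [(q, v)]) = map fst w' @ [q, v]"
      by (simp add: awalk_verts_conv)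
    moreover have "v \<notin> fst ` set w'"
      using w'(2) v(1) by auto
    moreover have "v \<noteq> q"
      using v(1,3) by auto
    ultimately show ?thesis
      using dist verts by (auto simp: c_def)
  qed
  have "c \<noteq> []"
    by (simp add: c_def)
  with c tl_c have "cycle c"
    unfolding cycle_def by (intro exI[of _ v] conjI)
  moreover have "length c \<ge> 3"
    using \<open>w' \<noteq> []\<close> by (cases w') (simp_all add: c_def)
  ultimately show False
    using G unfolding tree_graph_def by blast
qed

text \<open>By connectedness some arc leaves the list; its end vertex is appended.\<close>

lemma tree_list_extend:
  assumes G: "tree_graph G" and xs: "tree_list G xs" and ne: "set xs \<noteq> pverts G"
  shows "\<exists>v. tree_list G (xs @ [v])"
proof -
  interpret pair_graph G
    using G by (simp add: tree_graph_def)
  obtain x y where x: "x \<in> set xs" and y: "y \<in> pverts G" "y \<notin> set xs"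
    using xs ne by (cases xs) (auto simp: tree_list_def)
  have "x \<in> pverts G"
    using x xs by (auto simp: tree_list_def)
  \<comment> \<open>Connectedness refers to the symmetric closure, which here has the same arcs as
    \<open>G\<close>.\<close>
  let ?M = "with_proj (mk_symmetric (with_proj G))"
  have "x \<rightarrow>\<^sup>*\<^bsub>?M\<^esub> y"
    using G y(1) \<open>x \<in> pverts G\<close>
    by (auto simp: tree_graph_def Digraph_Component.connected_def strongly_connected_def mk_symmetric_def)
  then have "(x, y) \<in> (arcs_ends ?M)\<^sup>*"
    unfolding reachable_def by (rule rtrancl_on_rtranclI)
  moreover have "arcs_ends ?M = parcs G"
    using arcs_symmetric by (auto simp: arcs_ends_def arc_to_ends_def mk_symmetric_def)
  ultimately have "(x, y) \<in> (parcs G)\<^sup>*"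
    by simp
  then have "\<exists>p v. p \<in> set xs \<and> v \<notin> set xs \<and> (p, v) \<in> parcs G"
    using x y(2) by (induction rule: rtrancl_induct) auto
  then obtain p v where p: "p \<in> set xs" and v: "v \<notin> set xs" and pv: "(p, v) \<in> parcs G"
    by blast
  have vp: "(v, p) \<in> parcs G"
    by (rule arcs_symmetric[OF pv])
  obtain k where k: "k < length xs" "xs ! k = p"
    using p by (auto simp: in_set_conv_nth)
  have awalk1: "awalk p [(p, v)] v" "awalk v [(v, p)] p" "awalk v [] v"
    using pv vp by (auto simp: awalk_Cons_iff awalk_Nil_iff dest: wellformed')
  have "\<exists>!j. j < i \<and> ((xs @ [v]) ! i, (xs @ [v]) ! j) \<in> parcs G"
    if i: "i < length (xs @ [v])" "0 < i" for i
  proof (cases "i < length xs")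
    case True
    then have "\<exists>!j. j < i \<and> (xs ! i, xs ! j) \<in> parcs G"
      using xs i(2) unfolding tree_list_def by blast
    moreover have "(j < i \<and> ((xs @ [v]) ! i, (xs @ [v]) ! j) \<in> parcs G) =
        (j < i \<and> (xs ! i, xs ! j) \<in> parcs G)" for j
      using True by (auto simp: nth_append)
    ultimately show ?thesis
      by simp
  next
    case False
    then have [simp]: "i = length xs"
      using i by simp
    show ?thesis
    proof (rule ex1I[of _ k])
      show "k < i \<and> ((xs @ [v]) ! i, (xs @ [v]) ! k) \<in> parcs G"
        using k vp by (simp add: nth_append)
      fix j assume j: "j < i \<and> ((xs @ [v]) ! i, (xs @ [v]) ! j) \<in> parcs G"
      then have "xs ! j = p"
        using tree_list_unique_neighbour[OF G xs v _ p _ vp, of "xs ! j"] by (auto simp: nth_append)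
      then show "j = k"
        using j k xs by (auto simp: tree_list_def nth_eq_iff_index_eq)
    qed
  qed
  moreover have "\<exists>w. awalk a w b \<and> set w \<subseteq> set (xs @ [v]) \<times> set (xs @ [v])"
    if ab: "a \<in> set (xs @ [v])" "b \<in> set (xs @ [v])" for a b
  proof -
    have *: "\<exists>w. awalk a w b \<and> set w \<subseteq> set xs \<times> set xs" if "a \<in> set xs" "b \<in> set xs" for a b
      using xs that unfolding tree_list_def by blast
    consider "a \<in> set xs" "b \<in> set xs" | "a = v" "b = v" | "a = v" "b \<in> set xs" | "a \<in> set xs" "b = v"
      using ab by auto
    then show ?thesis
    proof cases
      case 1
      then show ?thesis
        using *[of a b] by fastforce
    next
      case 2
      then show ?thesis
        using awalk1(3) by (intro exI[of _ "[]"]) auto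
    next
      case 3
      then obtain w where "awalk p w b" "set w \<subseteq> set xs \<times> set xs"
        using *[OF p] by blast
      then show ?thesis
        using 3 p awalk_appendI[OF awalk1(2)] by (intro exI[of _ "[(v, p)] @ w"]) auto
    next
      case 4
      then obtain w where "awalk a w p" "set w \<subseteq> set xs \<times> set xs"
        using *[OF _ p] by blast
      then show ?thesis
        using 4 p awalk_appendI[OF _ awalk1(1)] by (intro exI[of _ "w @ [(p, v)]"]) auto
    qed
  qed
  moreover have "distinct (xs @ [v])" "set (xs @ [v]) \<subseteq> pverts G"
    using xs v in_arcsD1[OF vp] by (auto simp: tree_list_def)
  ultimately have "tree_list G (xs @ [v])"
    unfolding tree_list_def by (intro conjI allI impI ballI) simp_all
  then show ?thesis ..
qed

text \<open>A longest \<open>tree_list\<close> is spanning because it cannot be extended. The parent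
  of a vertex is its unique earlier neighbour.\<close>

lemma tree_parents:
  assumes G: "tree_graph G"
  obtains xs par where "distinct xs" "set xs = pverts G"
    "\<And>i. 0 < i \<Longrightarrow> par i < i"
    "\<And>i j. i < length xs \<Longrightarrow> j < length xs \<Longrightarrow> (xs ! i, xs ! j) \<in> parcs G \<Longrightarrow>
       (0 < i \<and> j = par i) \<or> (0 < j \<and> i = par j)"
proof -
  interpret pair_graph G
    using G by (simp add: tree_graph_def)
  have "pverts G \<noteq> {}"
    using G by (auto simp: tree_graph_def Digraph_Component.connected_def strongly_connected_def mk_symmetric_def)
  then obtain r where "r \<in> pverts G"
    by blast
  then have "tree_list G [r]"
    by (auto simp: tree_list_def awalk_Nil_iff intro!: exI[of _ "[]"])
  moreover have "length xs < Suc (card (pverts G))" if "tree_list G xs" for xs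
    using that card_mono[OF pair_finite_verts, of "set xs"] distinct_card[of xs]
    by (simp add: tree_list_def)
  ultimately obtain xs where xs: "tree_list G xs" "\<And>ys. tree_list G ys \<Longrightarrow> length ys \<le> length xs"
    using ex_has_greatest_nat[of "tree_list G" "[r]" length "Suc (card (pverts G))"]
    by (auto simp del: less_Suc_eq_le)
  have set_xs: "set xs = pverts G"
  proof (rule ccontr)
    assume "set xs \<noteq> pverts G"
    then obtain v where "tree_list G (xs @ [v])"
      using tree_list_extend[OF G xs(1)] by blast
    from xs(2)[OF this] show False
      by simp
  qed
  \<comment> \<open>Beyond the list, the value 0 keeps \<open>par i < i\<close> true for every
    positive \<open>i\<close>.\<close>
  define par where "par i = (if i < length xs then THE j. j < i \<and> (xs ! i, xs ! j) \<in> parcs G else 0)" for i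
  have ex1: "\<exists>!j. j < i \<and> (xs ! i, xs ! j) \<in> parcs G" if "i < length xs" "0 < i" for i
    using xs(1) that by (simp add: tree_list_def)
  have "par i < i" if "0 < i" for i
    using theI'[OF ex1[of i]] that by (auto simp: par_def)
  moreover have par_eq: "par i = j" if "i < length xs" "j < i" "(xs ! i, xs ! j) \<in> parcs G" for i j
    using the1_equality[OF ex1[of i], of j] that by (simp add: par_def)
  moreover have "(0 < i \<and> j = par i) \<or> (0 < j \<and> i = par j)"
    if "i < length xs" "j < length xs" "(xs ! i, xs ! j) \<in> parcs G" for i j
  proof (cases i j rule: linorder_cases)
    case less
    then show ?thesis
      using that par_eq[of j i]
        arcs_symmetric[of "xs ! i" "xs ! j"] by auto
  next
    case equal
    then show ?thesis
      using that no_loops'[of "xs ! i" "xs ! j"] by auto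
  next
    case greater
    then show ?thesis
      using that par_eq[of i j]
      by auto
  qed
  ultimately show ?thesis
    using that[of xs par] xs(1) set_xs by (auto simp: tree_list_def)
qed

section \<open>Graphs without four-cycles\<close>

text \<open>Characteristic two is inherited from \<open>bit\<close>. The closure is used because it
  contains a field of each order \<open>2 ^ k\<close>.\<close>

lemma bit_closure_two: "(2 :: bit alg_closure) = 0"
  using to_ac_numeral[of "num.Bit0 num.One", where 'a = bit] by simp

text \<open>Squaring is additive because the mixed term \<open>2 * x * y\<close> vanishes; this is
  iterated \<open>k\<close> times.\<close>

lemma bit_closure_frobenius: "(x + y) ^ 2 ^ k = x ^ 2 ^ k + y ^ 2 ^ k" for x y :: "bit alg_closure"
proof (induction k)
  case (Suc k)
  have "(x + y) ^ 2 ^ Suc k = ((x + y) ^ 2 ^ k)\<^sup>2"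
    by (simp add: mult.commute flip: power_mult)
  also have "\<dots> = (x ^ 2 ^ k)\<^sup>2 + (y ^ 2 ^ k)\<^sup>2 + 2 * x ^ 2 ^ k * y ^ 2 ^ k"
    unfolding Suc.IH by (simp add: power2_sum)
  finally show ?case
    by (simp add: bit_closure_two mult.commute flip: power_mult)
qed simp

text \<open>The roots of \<open>X ^ q - X\<close> form a field with \<open>q\<close> elements when \<open>q\<close> is a power of two.\<close>

lemma card_bit_closure_fixed:
  assumes "k > 0"
  shows "card {x :: bit alg_closure. x ^ 2 ^ k = x} = 2 ^ k"
proof -
  define q :: nat where "q = 2 ^ k"
  have q: "q > 1"
    using assms unfolding q_def by (metis one_less_numeral_iff one_less_power semiring_norm(76))
  define P :: "bit alg_closure poly" where "P = monom 1 q - monom 1 1"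
  have deg: "degree P = q"
    using q degree_add_eq_left[of "- monom 1 1" "monom 1 q :: bit alg_closure poly"]
    by (simp add: P_def degree_monom_eq)
  then have "P \<noteq> 0"
    using q by auto
  have poly_P: "poly P x = x ^ q - x" for x
    by (simp add: P_def poly_monom)
  have "of_nat q = (0 :: bit alg_closure)"
    using assms by (simp add: q_def bit_closure_two)
  then have deriv: "pderiv P = - 1"
    by (simp add: P_def pderiv_diff pderiv_monom monom_0 one_pCons)
  obtain A where A: "size A = q" "P = smult (lead_coeff P) (\<Prod>x\<in>#A. [:- x, 1:])"
    using alg_closed_imp_factorization[OF \<open>P \<noteq> 0\<close>] deg by metis
  have "lead_coeff P \<noteq> 0"
    using \<open>P \<noteq> 0\<close> by simp
  have roots: "poly P x = 0 \<longleftrightarrow> x \<in># A" for x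
    by (subst A(2), simp add: \<open>lead_coeff P \<noteq> 0\<close> poly_prod_mset prod_mset_zero_iff) (use \<open>P \<noteq> 0\<close> in auto)
  \<comment> \<open>A double root would also be a root of the derivative, which is the constant -1.
    So \<open>P\<close>, which splits, has \<open>q\<close> distinct roots.\<close>
  have "count A x \<le> 1" for x
  proof (rule ccontr)
    assume "\<not> count A x \<le> 1"
    then have "{#x, x#} \<subseteq># A"
      by (auto simp: subseteq_mset_def)
    then obtain B where "A = {#x, x#} + B"
      by (auto simp: mset_subset_eq_exists_conv)
    then have "P = [:- x, 1:] * ([:- x, 1:] * smult (lead_coeff P) (\<Prod>x\<in>#B. [:- x, 1:]))"
      using A(2) by simp
    then have "poly (pderiv P) x = poly (pderiv
        ([:- x, 1:] * ([:- x, 1:] * smult (lead_coeff P) (\<Prod>x\<in>#B. [:- x, 1:])))) x"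
      by (rule arg_cong[where f = "\<lambda>p. poly (pderiv p) x"])
    also have "\<dots> = 0"
      unfolding pderiv_mult[of "[:- x, 1:]"] by simp
    finally show False
      by (simp add: deriv)
  qed
  then have "count A x = 1" if "x \<in># A" for x
    using that by (simp add: order_antisym Suc_le_eq)
  then have "card (set_mset A) = size A"
    by (simp add: size_multiset_overloaded_eq)
  moreover have "{x. x ^ 2 ^ k = x} = set_mset A"
    using roots by (auto simp: poly_P q_def)
  ultimately show ?thesis
    using A(1) by (simp add: q_def)
qed

section \<open>The two bounds\<close>

lemma ex_min_degree:
  fixes \<delta> :: real
  assumes G: "pair_graph G" and \<delta>: "card (uedges G) > \<delta> * real (card (pverts G))"
  shows "\<exists>U\<subseteq>pverts G. U \<noteq> {} \<and> (\<forall>x\<in>U. \<delta> \<le> card {y \<in> U. (x, y) \<in> parcs G})"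
proof -
  interpret pair_graph G by fact
  \<comment> \<open>In a maximiser \<open>U\<close> of \<open>f\<close>, a vertex of degree below
    \<open>\<delta>\<close> could be deleted to increase \<open>f\<close>. It is nonempty because
    \<open>f\<close> is positive at \<open>pverts G\<close> and zero at the empty set.\<close>
  define f where "f U = card {e \<in> uedges G. e \<subseteq> U} - \<delta> * card U" for U
  have fin: "finite (uedges G)"
    unfolding uedges_def using pair_finite_arcs by simp
  have "finite (f ` Pow (pverts G))" "f ` Pow (pverts G) \<noteq> {}"
    using pair_finite_verts by auto
  from Max_in[OF this] obtain U where U: "U \<subseteq> pverts G" "Max (f ` Pow (pverts G)) = f U"
    by auto
  have max: "f W \<le> f U" if "W \<subseteq> pverts G" for W
    using U(2) that Max_ge[OF \<open>finite (f ` Pow (pverts G))\<close>, of "f W"] by auto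
  have finU: "finite U"
    using U(1) pair_finite_verts by (rule finite_subset)
  have "{e \<in> uedges G. e \<subseteq> pverts G} = uedges G"
    by (auto simp: uedges_def dest: wellformed')
  then have "f (pverts G) > 0"
    using \<delta> by (simp add: f_def)
  then have "f U > 0"
    using max[of "pverts G"] by simp
  moreover have "f {} = 0"
    by (auto simp: f_def uedges_def intro!: card_eq_0_iff[THEN iffD2])
  ultimately have "U \<noteq> {}"
    by auto
  moreover have "\<delta> \<le> card {y \<in> U. (x, y) \<in> parcs G}" if x: "x \<in> U" for x
  proof -
    have "{e \<in> uedges G. e \<subseteq> U} \<subseteq>
        {e \<in> uedges G. e \<subseteq> U - {x}} \<union> (\<lambda>y. {x, y}) ` {y \<in> U. (x, y) \<in> parcs G}"
    proof
      fix e assume e: "e \<in> {e \<in> uedges G. e \<subseteq> U}"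
      then obtain u v where uv: "e = {u, v}" "(u, v) \<in> parcs G"
        by (auto simp: uedges_def)
      show "e \<in> {e \<in> uedges G. e \<subseteq> U - {x}} \<union> (\<lambda>y. {x, y}) ` {y \<in> U. (x, y) \<in> parcs G}"
        using e uv arcs_symmetric[OF uv(2)] by (cases "x = u"; cases "x = v") auto
    qed
    then have "card {e \<in> uedges G. e \<subseteq> U} \<le>
        card ({e \<in> uedges G. e \<subseteq> U - {x}} \<union> (\<lambda>y. {x, y}) ` {y \<in> U. (x, y) \<in> parcs G})"
      using fin finU by (intro card_mono) auto
    also have "\<dots> \<le> card {e \<in> uedges G. e \<subseteq> U - {x}} + card {y \<in> U. (x, y) \<in> parcs G}"
      using finU by (intro order_trans[OF card_Un_le] add_left_mono card_image_le) auto
    finally have "real (card {e \<in> uedges G. e \<subseteq> U}) \<le>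
        card {e \<in> uedges G. e \<subseteq> U - {x}} + card {y \<in> U. (x, y) \<in> parcs G}"
      by linarith
    moreover have "f (U - {x}) \<le> f U"
      using U(1) by (intro max) auto
    moreover have "real (card U) = card (U - {x}) + 1"
      using card_Suc_Diff1[OF finU x] by linarith
    ultimately show ?thesis
      by (simp add: f_def algebra_simps)
  qed
  ultimately show ?thesis
    using U(1) by blast
qed

text \<open>In lexicographic order, \<open>preds\<close> come first because one coordinate agrees
  and the other is smaller.\<close>

lemma (in tree_process) admissible_product:
  "admissible (List.product [0..<t] [0..<s])"
proof (induction t)
  case (Suc t)
  have "admissible (List.product [0..<t] [0..<s] @ map (Pair t) [0..<m])" if "m \<le> s" for m
    using that
  proof (induction m)
    case (Suc m)
    have "preds (t, m) \<subseteq> set (List.product [0..<t] [0..<s] @ map (Pair t) [0..<m])"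
      using Suc.prems par_less[of t] par'_less[of m] by (auto simp: preds_def)
    then have "admissible ((List.product [0..<t] [0..<s] @ map (Pair t) [0..<m]) @ [(t, m)])"
      using Suc by (intro admissible.snoc) auto
    then show ?case
      by simp
  qed (use Suc in simp)
  from this[of s] show ?case
    by (simp add: product_concat_map)
qed (simp add: admissible.Nil)

text \<open>A subset \<open>U\<close> with minimum degree at least \<open>\<delta>\<close> hosts the
  random map, whose grid is given by enumerations of the two trees.\<close>

lemma contains_box_product:
  assumes T: "tree_graph T" and S: "tree_graph S" and G: "pair_graph G"
    and edges: "card (uedges G) >
      real (card (pverts T) * card (pverts S) + 1) * real (card (pverts G)) powr (3 / 2)"
  shows "contains_copy G (box_product T S)"
proof -
  interpret G: pair_graph G by fact
  interpret T: pair_graph T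
    using T by (simp add: tree_graph_def)
  interpret S: pair_graph S
    using S by (simp add: tree_graph_def)
  define n where "n = card (pverts G)"
  define N where "N = card (pverts T) * card (pverts S)"
  \<comment> \<open>The summand 1 makes the inequality required by \<open>ex_embedding\<close>
    strict, as \<open>card U \<le> n\<close>.\<close>
  define \<delta> where "\<delta> = (N + 1) * sqrt n"
  have "n > 0"
  proof (rule ccontr)
    assume "\<not> n > 0"
    then have "pverts G = {}"
      using G.pair_finite_verts by (simp add: n_def)
    then have "parcs G = {}"
      using G.wellformed' by auto
    then have "real (card (uedges G)) = 0"
      by (simp add: uedges_def)
    moreover have "0 \<le> real (card (pverts T) * card (pverts S) + 1) * real (card (pverts G)) powr (3 / 2)"
      by (intro mult_nonneg_nonneg) simp_all
    ultimately show False
      using edges by linarith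
  qed
  then have "real n powr (3 / 2) = sqrt n * n"
    using powr_add[of "real n" "1 / 2" 1] by (simp add: powr_half_sqrt)
  then have "card (uedges G) > \<delta> * card (pverts G)"
    using edges by (simp add: \<delta>_def N_def n_def mult.assoc)
  from ex_min_degree[OF G this] obtain U where U: "U \<subseteq> pverts G" "U \<noteq> {}"
      "\<And>x. x \<in> U \<Longrightarrow> \<delta> \<le> card {y \<in> U. (x, y) \<in> parcs G}"
    by blast
  have "\<delta> > 0"
    using \<open>n > 0\<close> by (simp add: \<delta>_def)
  have finU: "finite U"
    using U(1) G.pair_finite_verts by (rule finite_subset)
  obtain xs par where xs: "distinct xs" "set xs = pverts T" "\<And>i. 0 < i \<Longrightarrow> par i < i"
    "\<And>i j. i < length xs \<Longrightarrow> j < length xs \<Longrightarrow> (xs ! i, xs ! j) \<in> parcs T \<Longrightarrow>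
       (0 < i \<and> j = par i) \<or> (0 < j \<and> i = par j)"
    by (rule tree_parents[OF T], rule that)
  obtain ys par' where ys: "distinct ys" "set ys = pverts S" "\<And>i. 0 < i \<Longrightarrow> par' i < i"
    "\<And>i j. i < length ys \<Longrightarrow> j < length ys \<Longrightarrow> (ys ! i, ys ! j) \<in> parcs S \<Longrightarrow>
       (0 < i \<and> j = par' i) \<or> (0 < j \<and> i = par' j)"
    by (rule tree_parents[OF S], rule that)
  interpret P: tree_process U "parcs G" par par'
  proof
    show "\<exists>y\<in>U. (x, y) \<in> parcs G" if "x \<in> U" for x
    proof (rule ccontr)
      assume "\<not> (\<exists>y\<in>U. (x, y) \<in> parcs G)"
      then have "{y \<in> U. (x, y) \<in> parcs G} = {}"
        by blast
      then have "card {y \<in> U. (x, y) \<in> parcs G} = 0"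
        by (simp only: card.empty)
      then show False
        using U(3)[OF that] \<open>\<delta> > 0\<close> by linarith
    qed
  qed (use finU U(2) xs(3) ys(3) in \<open>auto intro: G.arcs_symmetric\<close>)
  have deg: "\<delta> \<le> P.deg x" if "x \<in> U" for x
    using U(3)[OF that] finU by (simp add: P.deg_def Int_def)
  define us where "us = List.product [0..<length xs] [0..<length ys]"
  have len: "length us = N"
    using distinct_card[OF xs(1)] distinct_card[OF ys(1)] xs(2) ys(2) by (simp add: us_def N_def)
  have "card U \<le> n"
    unfolding n_def using U(1) G.pair_finite_verts by (rule card_mono[rotated])
  then have "real (N\<^sup>2 * card U) \<le> (real N)\<^sup>2 * n"
    by (simp add: mult_left_mono)
  also have "\<dots> < (real N + 1)\<^sup>2 * n"
    using \<open>n > 0\<close> by (intro mult_strict_right_mono power_strict_mono) auto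
  also have "\<dots> = \<delta>\<^sup>2"
    by (simp add: \<delta>_def power_mult_distrib add.commute)
  finally have "real ((length us)\<^sup>2 * card U) < \<delta>\<^sup>2"
    by (simp add: len)
  from P.ex_embedding[OF \<open>\<delta> > 0\<close> deg _ this] P.admissible_product
  obtain Y where Y: "Y ` set us \<subseteq> U" "inj_on Y (set us)"
      "\<And>u v. u \<in> set us \<Longrightarrow> v \<in> set us \<Longrightarrow> P.stair_step u v \<Longrightarrow> (Y u, Y v) \<in> parcs G"
    unfolding us_def by blast
  \<comment> \<open>Positions in the enumerations turn vertices of the product into grid
    coordinates.\<close>
  define ix where "ix = the_inv_into {..<length xs} ((!) xs)"
  define iy where "iy = the_inv_into {..<length ys} ((!) ys)"
  have ix: "ix u < length xs" "xs ! ix u = u" if "u \<in> pverts T" for u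
    using that xs(1,2) bij_betw_nth[OF xs(1) refl refl]
      the_inv_into_into[of "(!) xs" "{..<length xs}" u "{..<length xs}"]
      f_the_inv_into_f[of "(!) xs" "{..<length xs}" u]
    by (auto simp: ix_def bij_betw_def)
  have iy: "iy u < length ys" "ys ! iy u = u" if "u \<in> pverts S" for u
    using that ys(1,2) bij_betw_nth[OF ys(1) refl refl]
      the_inv_into_into[of "(!) ys" "{..<length ys}" u "{..<length ys}"]
      f_the_inv_into_f[of "(!) ys" "{..<length ys}" u]
    by (auto simp: iy_def bij_betw_def)
  have sub: "(ix u, iy v) \<in> set us" if "u \<in> pverts T" "v \<in> pverts S" for u v
    using ix iy that by (simp add: us_def)
  have arc: "(Y p, Y q) \<in> parcs G"
    if "p \<in> set us" "q \<in> set us" "P.stair_step p q \<or> P.stair_step q p" for p q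
    using that Y(3) G.arcs_symmetric by blast
  show ?thesis
    unfolding contains_copy_iff_embedding[OF pair_graph_box_product[OF T.pair_graph S.pair_graph] G]
  proof (intro exI[of _ "\<lambda>(u, v). Y (ix u, iy v)"] conjI allI impI)
    show "inj_on (\<lambda>(u, v). Y (ix u, iy v)) (pverts (box_product T S))"
    proof (rule inj_onI, clarify)
      fix u v u' v' assume *: "(u, v) \<in> pverts (box_product T S)"
        "(u', v') \<in> pverts (box_product T S)" "Y (ix u, iy v) = Y (ix u', iy v')"
      then have mem: "u \<in> pverts T" "u' \<in> pverts T" "v \<in> pverts S" "v' \<in> pverts S"
        by (auto simp: box_product_def)
      then have "(ix u, iy v) = (ix u', iy v')"
        using *(3) Y(2) sub by (auto simp: inj_on_def)
      then show "u = u' \<and> v = v'"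
        using ix(2) iy(2) mem by (metis Pair_inject)
    qed
    show "(\<lambda>(u, v). Y (ix u, iy v)) ` pverts (box_product T S) \<subseteq> pverts G"
      using Y(1) U(1) sub by (fastforce simp: box_product_def)
    fix p q assume pq: "(p, q) \<in> parcs (box_product T S)"
    obtain u v u' v' where [simp]: "p = (u, v)" "q = (u', v')"
      by (cases p; cases q)
    have mem: "u \<in> pverts T" "u' \<in> pverts T" "v \<in> pverts S" "v' \<in> pverts S"
      and cases: "u = u' \<and> (v, v') \<in> parcs S \<or> v = v' \<and> (u, u') \<in> parcs T"
      using pq by (auto simp: box_product_def)
    have "P.stair_step (ix u, iy v) (ix u', iy v') \<or> P.stair_step (ix u', iy v') (ix u, iy v)"
      using cases
    proof
      assume "u = u' \<and> (v, v') \<in> parcs S"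
      then show ?thesis
        using ys(4)[of "iy v" "iy v'"] iy mem by (auto simp: P.stair_step_def)
    next
      assume "v = v' \<and> (u, u') \<in> parcs T"
      then show ?thesis
        using xs(4)[of "ix u" "ix u'"] ix mem by (auto simp: P.stair_step_def)
    qed
    then show "((\<lambda>(u, v). Y (ix u, iy v)) p, (\<lambda>(u, v). Y (ix u, iy v)) q) \<in> parcs G"
      using arc sub mem by simp
  qed
qed

section \<open>Four-cycle-free graphs with many edges\<close>

text \<open>The incidence graph of the points and the lines \<open>y = m * x + b\<close> over the field with \<open>2 ^ k\<close>
  elements, together with isolated vertices.\<close>

lemma ex_four_cycle_free:
  assumes k: "k > 0" and n: "2 * 4 ^ k \<le> n"
  shows "\<exists>G :: nat pair_pre_digraph. pair_graph G \<and> card (pverts G) = n \<and> 8 ^ k \<le> card (uedges G) \<and>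
    (\<forall>a b c d. (a, b) \<in> parcs G \<longrightarrow> (b, c) \<in> parcs G \<longrightarrow> (c, d) \<in> parcs G \<longrightarrow> (d, a) \<in> parcs G \<longrightarrow>
       a = c \<or> b = d)"
proof -
  define F where "F = {x :: bit alg_closure. x ^ 2 ^ k = x}"
  have card_F: "card F = 2 ^ k"
    unfolding F_def by (rule card_bit_closure_fixed[OF k])
  then have fin_F: "finite F"
    using card.infinite by fastforce
  have closed: "m * x + b \<in> F" if "m \<in> F" "x \<in> F" "b \<in> F" for m x b
    using that by (simp add: F_def bit_closure_frobenius power_mult_distrib)
  define Q :: nat where "Q = 4 ^ k"
  have "card (F \<times> F) = Q"
    by (simp add: card_cartesian_product card_F Q_def flip: power_mult_distrib)
  then obtain h where h: "bij_betw h (F \<times> F) {0..<Q}"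
    using ex_bij_betw_finite_nat[of "F \<times> F"] fin_F by auto
  have h_less: "h p < Q" if "p \<in> F \<times> F" for p
    using h that by (auto simp: bij_betw_def)
  have h_eq: "h p = h p' \<longleftrightarrow> p = p'" if "p \<in> F \<times> F" "p' \<in> F \<times> F" for p p'
    using h that by (auto simp: bij_betw_def inj_on_def)
  \<comment> \<open>One edge per incidence of the point \<open>(x, m * x + b)\<close> with the line
    of slope \<open>m\<close> and intercept \<open>b\<close>. The shift by \<open>Q\<close>
    separates lines from points.\<close>
  define g where "g = (\<lambda>(x, m, b). (h (x, m * x + b), Q + h (m, b)))"
  define A where "A = g ` (F \<times> F \<times> F)"
  define G where "G = \<lparr> pverts = {..<n}, parcs = A \<union> A\<inverse> \<rparr>"
  have A_less: "u < Q" "Q \<le> v" "v < n" if "(u, v) \<in> A" for u v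
  proof -
    from that obtain x m b where *: "x \<in> F" "m \<in> F" "b \<in> F" "u = h (x, m * x + b)" "v = Q + h (m, b)"
      by (auto simp: A_def g_def)
    show "u < Q" "Q \<le> v"
      using * h_less closed by auto
    show "v < n"
      using * h_less[of "(m, b)"] n by (auto simp: Q_def)
  qed
  have fin_A: "finite A"
    using fin_F by (simp add: A_def)
  have G: "pair_graph G"
  proof
    show "finite (parcs G)"
      using fin_A by (simp add: G_def)
    show "symmetric (with_proj G)"
      by (auto simp: G_def symmetric_def sym_def)
    show "fst e \<in> pverts G" "snd e \<in> pverts G" if "e \<in> parcs G" for e
      using that A_less[of "fst e" "snd e"] A_less[of "snd e" "fst e"] by (cases e, force simp: G_def)+
    show "fst e \<noteq> snd e" if "e \<in> parcs G" for e
      using that A_less[of "fst e" "snd e"] A_less[of "snd e" "fst e"] by (cases e, force simp: G_def)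
  qed (simp add: G_def)
  have "inj_on g (F \<times> F \<times> F)"
    using h_eq closed by (auto simp: inj_on_def g_def)
  then have "card A = card (F \<times> F \<times> F)"
    unfolding A_def by (rule card_image)
  also have "\<dots> = 8 ^ k"
    by (simp add: card_cartesian_product card_F flip: power_mult_distrib)
  finally have "card A = 8 ^ k" .
  moreover have "inj_on (\<lambda>(u, v). {u, v}) A"
    using A_less by (fastforce simp: inj_on_def doubleton_eq_iff)
  then have "card ((\<lambda>(u, v). {u, v}) ` A) = card A"
    by (rule card_image)
  moreover have "card ((\<lambda>(u, v). {u, v}) ` A) \<le> card (uedges G)"
    unfolding uedges_def using fin_A by (intro card_mono) (auto simp: G_def)
  ultimately have edges: "8 ^ k \<le> card (uedges G)"
    by simp
  \<comment> \<open>Two points \<open>a\<close>, \<open>c\<close> lie on two lines \<open>b\<close>,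
    \<open>d\<close>. Subtracting the equations gives \<open>(m - m') * (x - x') = 0\<close>, so the
    lines or the points agree.\<close>
  have lines: "a = c \<or> b = d" if A: "(a, b) \<in> A" "(c, b) \<in> A" "(c, d) \<in> A" "(a, d) \<in> A" for a b c d
  proof -
    obtain x m \<beta> where 1: "x \<in> F" "m \<in> F" "\<beta> \<in> F" "a = h (x, m * x + \<beta>)" "b = Q + h (m, \<beta>)"
      using A(1) by (auto simp: A_def g_def)
    obtain x' m' \<beta>' where 2: "x' \<in> F" "m' \<in> F" "\<beta>' \<in> F" "c = h (x', m' * x' + \<beta>')" "d = Q + h (m', \<beta>')"
      using A(3) by (auto simp: A_def g_def)
    obtain x1 m1 \<beta>1 where 3: "x1 \<in> F" "m1 \<in> F" "\<beta>1 \<in> F" "c = h (x1, m1 * x1 + \<beta>1)" "b = Q + h (m1, \<beta>1)"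
      using A(2) by (auto simp: A_def g_def)
    obtain x2 m2 \<beta>2 where 4: "x2 \<in> F" "m2 \<in> F" "\<beta>2 \<in> F" "a = h (x2, m2 * x2 + \<beta>2)" "d = Q + h (m2, \<beta>2)"
      using A(4) by (auto simp: A_def g_def)
    have "m1 = m" "\<beta>1 = \<beta>" "m2 = m'" "\<beta>2 = \<beta>'"
      using 1 2 3 4 h_eq[of "(m1, \<beta>1)" "(m, \<beta>)"] h_eq[of "(m2, \<beta>2)" "(m', \<beta>')"] by auto
    then have "x1 = x'" "m * x' + \<beta> = m' * x' + \<beta>'" "x2 = x" "m' * x + \<beta>' = m * x + \<beta>"
      using 1 2 3 4 closed h_eq[of "(x1, m1 * x1 + \<beta>1)" "(x', m' * x' + \<beta>')"]
        h_eq[of "(x2, m2 * x2 + \<beta>2)" "(x, m * x + \<beta>)"] by auto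
    moreover from this have "(m - m') * x' = \<beta>' - \<beta>" "(m - m') * x = \<beta>' - \<beta>"
      by (simp_all add: algebra_simps)
    ultimately have "(m - m') * (x - x') = 0"
      by (simp add: right_diff_distrib)
    then have "m = m' \<or> x = x'"
      by simp
    then show ?thesis
      using 1 2 \<open>m' * x + \<beta>' = m * x + \<beta>\<close> by auto
  qed
  have arc: "(u < Q \<and> (u, v) \<in> A \<and> Q \<le> v) \<or> (Q \<le> u \<and> (v, u) \<in> A \<and> v < Q)"
    if "(u, v) \<in> parcs G" for u v
  proof -
    have "(u, v) \<in> A \<or> (v, u) \<in> A"
      using that by (simp add: G_def)
    then show ?thesis
      using A_less(1,2)[of u v] A_less(1,2)[of v u] by blast
  qed
  have "a = c \<or> b = d"
    if "(a, b) \<in> parcs G" "(b, c) \<in> parcs G" "(c, d) \<in> parcs G" "(d, a) \<in> parcs G" for a b c d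
  \<comment> \<open>Edges join points to lines. If \<open>a\<close> is a line, the cycle is read
    from the point \<open>b\<close> on.\<close>
  proof (cases "a < Q")
    case True
    then have "(a, b) \<in> A" "(c, b) \<in> A" "(c, d) \<in> A" "(a, d) \<in> A"
      using that[THEN arc] by auto
    then show ?thesis
      by (rule lines)
  next
    case False
    then have "(b, a) \<in> A" "(d, a) \<in> A" "(d, c) \<in> A" "(b, c) \<in> A"
      using that[THEN arc] by auto
    then have "b = d \<or> a = c"
      using lines[of b a d c] by blast
    then show ?thesis
      by blast
  qed
  then show ?thesis
    using G edges by (intro exI[of _ G]) (auto simp: G_def)
qed

text \<open>Rounding \<open>n div 2\<close> down to a power of four costs a factor below 4 there;
  this is the origin of the constant \<open>1 / 8\<close> in the lower bound.\<close>

lemma ex_power_four: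
  assumes "n \<ge> (8 :: nat)"
  shows "\<exists>k>0. 2 * 4 ^ k \<le> n \<and> n < 8 * 4 ^ k"
proof -
  have "1 \<le> n div 2"
    using assms by linarith
  then obtain k where k: "4 ^ k \<le> n div 2" "n div 2 < 4 ^ (k + 1)"
    using ex_power_ivl1[of 4 "n div 2"] by auto
  have "k > 0"
    using k(2) assms by (cases k) auto
  with k show ?thesis
    by (intro exI[of _ k]) auto
qed

text \<open>An edge of \<open>T\<close> and an edge of \<open>S\<close> span a four-cycle in the
  product, so a four-cycle-free graph contains no copy. Its \<open>8 ^ k\<close> edges suffice since
  \<open>8 ^ k\<close> is the power \<open>3 / 2\<close> of \<open>4 ^ k\<close>.\<close>

lemma turan_number_lower:
  assumes T: "pair_graph T" "(t, t') \<in> parcs T" and S: "pair_graph S" "(s, s') \<in> parcs S"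
    and n: "n \<ge> 8"
  shows "(1 / 8) powr (3 / 2) * real n powr (3 / 2) \<le> turan_number n (box_product T S)"
proof -
  interpret T: pair_graph T by fact
  interpret S: pair_graph S by fact
  note box = pair_graph_box_product[OF T(1) S(1)]
  have arcs: "((t, s), (t', s)) \<in> parcs (box_product T S)" "((t', s), (t', s')) \<in> parcs (box_product T S)"
    "((t', s'), (t, s')) \<in> parcs (box_product T S)" "((t, s'), (t, s)) \<in> parcs (box_product T S)"
    using T(2) S(2) T.arcs_symmetric[OF T(2)] S.arcs_symmetric[OF S(2)]
    by (auto simp: box_product_def dest: T.wellformed' S.wellformed')
  obtain k where k: "k > 0" "2 * 4 ^ k \<le> n" "n < 8 * 4 ^ k"
    using ex_power_four[OF n] by blast
  obtain G :: "nat pair_pre_digraph" where G: "pair_graph G" "card (pverts G) = n" "8 ^ k \<le> card (uedges G)"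
    and free: "\<And>a b c d. (a, b) \<in> parcs G \<Longrightarrow> (b, c) \<in> parcs G \<Longrightarrow> (c, d) \<in> parcs G \<Longrightarrow>
      (d, a) \<in> parcs G \<Longrightarrow> a = c \<or> b = d"
    using ex_four_cycle_free[OF k(1,2)] by blast
  have "\<not> contains_copy G (box_product T S)"
    unfolding contains_copy_iff_embedding[OF box G(1)]
  proof
    assume "\<exists>f. inj_on f (pverts (box_product T S)) \<and> f ` pverts (box_product T S) \<subseteq> pverts G \<and>
      (\<forall>u v. (u, v) \<in> parcs (box_product T S) \<longrightarrow> (f u, f v) \<in> parcs G)"
    then obtain f where f: "inj_on f (pverts (box_product T S))"
        "\<And>u v. (u, v) \<in> parcs (box_product T S) \<Longrightarrow> (f u, f v) \<in> parcs G"
      by blast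
    have "f (t, s) = f (t', s') \<or> f (t', s) = f (t, s')"
      using arcs by (intro free f(2))
    moreover have "t \<noteq> t'"
      using T.no_loops'[OF T(2)] by simp
    moreover have "t \<in> pverts T" "t' \<in> pverts T" "s \<in> pverts S" "s' \<in> pverts S"
      using T.wellformed'[OF T(2)] S.wellformed'[OF S(2)] by auto
    ultimately show False
      using f(1) by (auto simp: inj_on_def box_product_def)
  qed
  then have le: "card (uedges G) \<le> turan_number n (box_product T S)"
    unfolding turan_number_def using G turan_number_attained(1)[OF box] arcs(1)
    by (intro Max_ge) blast+
  have "(1 / 8) powr (3 / 2) * real n powr (3 / 2) \<le> 8 ^ k"
  proof -
    have "(1 / 8) powr (3 / 2) * real n powr (3 / 2) = (real n / 8) powr (3 / 2)"
      by (subst powr_mult[symmetric]) simp_all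
    also have "\<dots> \<le> (4 ^ k) powr (3 / 2)"
    proof (rule powr_mono2)
      have "real n \<le> real (8 * 4 ^ k)"
        using k(3) by (intro of_nat_mono) simp
      then show "real n / 8 \<le> 4 ^ k"
        by simp
    qed auto
    also have "(4 :: real) ^ k = 2 powr (2 * k)"
      using powr_realpow[of 2 "2 * k"] by (simp add: power_mult)
    also have "\<dots> powr (3 / 2) = 2 powr (3 * k)"
      by (simp add: powr_powr)
    also have "\<dots> = 8 ^ k"
      using powr_realpow[of 2 "3 * k"] by (simp add: power_mult)
    finally show ?thesis .
  qed
  also have "8 ^ k = real (8 ^ k)"
    by simp
  also have "\<dots> \<le> turan_number n (box_product T S)"
    using le G(3) by (intro of_nat_mono) linarith
  finally show ?thesis .
qed

text \<open>An extremal graph contains no copy, so it cannot exceed the edge bound of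
  \<open>contains_box_product\<close>.\<close>

lemma turan_number_upper:
  assumes T: "tree_graph T" "(t, t') \<in> parcs T" and S: "tree_graph S" "(s, s') \<in> parcs S"
  shows "turan_number n (box_product T S) \<le>
    real (card (pverts T) * card (pverts S) + 1) * real n powr (3 / 2)"
proof -
  interpret T: pair_graph T
    using T by (simp add: tree_graph_def)
  interpret S: pair_graph S
    using S by (simp add: tree_graph_def)
  have "((t, s), (t', s)) \<in> parcs (box_product T S)"
    using T(2) S(2) by (auto simp: box_product_def dest: T.wellformed' S.wellformed')
  then have "parcs (box_product T S) \<noteq> {}"
    by blast
  note attained = turan_number_attained[OF pair_graph_box_product[OF T.pair_graph S.pair_graph] this]
  from Max_in[OF attained] obtain G :: "nat pair_pre_digraph" where
    "turan_number n (box_product T S) = card (uedges G)" "pair_graph G" "card (pverts G) = n"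
    "\<not> contains_copy G (box_product T S)"
    unfolding turan_number_def by blast
  then show ?thesis
    using contains_box_product[OF T(1) S(1), of G] by (force simp: not_less)
qed

theorem theorem1p5:
  fixes T :: "'a pair_pre_digraph" and S :: "'b pair_pre_digraph"
  assumes "tree_graph T" and "uedges T \<noteq> {}"
    and "tree_graph S" and "uedges S \<noteq> {}"
  shows "\<exists>c > 0. \<exists>C > 0. \<forall>\<^sub>F n in sequentially.
           c * real n powr (3 / 2) \<le> real (turan_number n (box_product T S)) \<and>
           real (turan_number n (box_product T S)) \<le> C * real n powr (3 / 2)"
proof -
  have "parcs T \<noteq> {}" "parcs S \<noteq> {}"
    using assms(2,4) by (auto simp: uedges_def)
  then obtain t t' s s' where arcs: "(t, t') \<in> parcs T" "(s, s') \<in> parcs S"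
    by auto
  have graphs: "pair_graph T" "pair_graph S"
    using assms(1,3) by (auto simp: tree_graph_def)
  have "\<forall>\<^sub>F n in sequentially.
      (1 / 8) powr (3 / 2) * real n powr (3 / 2) \<le> real (turan_number n (box_product T S)) \<and>
      real (turan_number n (box_product T S)) \<le>
        real (card (pverts T) * card (pverts S) + 1) * real n powr (3 / 2)"
    using eventually_ge_at_top[of 8]
    by eventually_elim
      (intro conjI turan_number_lower[OF graphs(1) arcs(1) graphs(2) arcs(2)]
        turan_number_upper[OF assms(1) arcs(1) assms(3) arcs(2)])
  moreover have "(1 / 8 :: real) powr (3 / 2) > 0"
    by simp
  moreover have "real (card (pverts T) * card (pverts S) + 1) > 0"
    by (subst of_nat_0_less_iff) simp
  ultimately show ?thesis
    by blast
qed

end
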